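(* Let $R$ be a commutative ring with identity and let $S$ be a multiplicative subset of $R$. The following assertions are equivalent: 1. $R$ is $S$-coherent. 2. Every $S$-finitely presented $R$-module is $S$-coherent. 3. Every finitely generated $R$-submodule of a free $R$-module is $S$-finitely presented. 4. $(I:a)$ is an $S$-finite ideal of $R$, for every finitely generated ideal $I$ of $R$ and every $a\in R$. 5. $(0:a)$ is an $S$-finite ideal of $R$ for every $a\in R$, and the intersection of any two finitely generated ideals of $R$ is an $S$-finite ideal of $R$.
   Context: All rings are commutative with identity and all modules are unitary. A multiplicative subset of $R$ is a subset containing $1$ and closed under multiplication. For an ideal $I$ of $R$ and $a\in R$, $(I:a)=\{x\in R : xa\in I\}$. An $R$-module $M$ is $S$-finite if there exist a finitely generated submodule $N$ of $M$ and $s\in S$ such that $sM\subseteq N$. An $R$-module $M$ is $S$-finitely presented if there exists an exact sequence of $R$-modules $0\to K\to F\to M\to 0$ with $K$ an $S$-finite module and $F$ a finitely generated free module. An $R$-module $M$ is $S$-coherent if it is finitely generated and every finitely generated submodule of $M$ is $S$-finitely presented. The ring $R$ is $S$-coherent if it is $S$-coherent as an $R$-module, i.e. every finitely generated ideal of $R$ is $S$-finitely presented. *)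

theory Defs
  imports "HOL-Algebra.Algebra" "Jordan_Normal_Form.Missing_VectorSpace"
begin

text \<open>
  Modules are those of \<^locale>\<open>module\<close> (HOL-Algebra): records with an explicit carrier over a ring
  with an explicit carrier. \<^term>\<open>M\<lparr>carrier := N\<rparr>\<close> is a submodule \<^term>\<open>N\<close> of \<^term>\<open>M\<close>
  regarded as a module in its own right.
\<close>

definition regular_module :: "('a, 'r) ring_scheme \<Rightarrow> ('a, 'a) module" where
  "regular_module R =
     \<lparr>carrier = carrier R, monoid.mult = (\<otimes>\<^bsub>R\<^esub>), one = \<one>\<^bsub>R\<^esub>,
      ring.zero = \<zero>\<^bsub>R\<^esub>, add = (\<oplus>\<^bsub>R\<^esub>), module.smult = (\<otimes>\<^bsub>R\<^esub>)\<rparr>"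

lemma (in cring) module_regular_module: "module R (regular_module R)"
  by (rule module_criteria)
     (auto simp: regular_module_def is_cring m_assoc l_distr r_distr a_ac intro: exI[of _ "\<ominus> _"] r_neg)

definition finitely_generated ::
  "('a, 'r) ring_scheme \<Rightarrow> ('a, 'm, 'x) module_scheme \<Rightarrow> bool" where
  "finitely_generated R M \<longleftrightarrow>
     (\<exists>A. finite A \<and> A \<subseteq> carrier M \<and> module.span R M A = carrier M)"

definition fg_submodule ::
  "('a, 'r) ring_scheme \<Rightarrow> 'm set \<Rightarrow> ('a, 'm, 'x) module_scheme \<Rightarrow> bool" where
  "fg_submodule R N M \<longleftrightarrow> submodule R N M \<and> finitely_generated R (M\<lparr>carrier := N\<rparr>)"

definition free_module ::
  "('a, 'r) ring_scheme \<Rightarrow> ('a, 'm, 'x) module_scheme \<Rightarrow> bool" where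
  "free_module R F \<longleftrightarrow> module R F \<and>
     (\<exists>B. B \<subseteq> carrier F \<and> \<not> module.lin_dep R F B \<and> module.span R F B = carrier F)"

definition short_exact ::
  "('a, 'r) ring_scheme \<Rightarrow> ('a, 'k, 'x) module_scheme \<Rightarrow> ('k \<Rightarrow> 'f) \<Rightarrow> ('a, 'f, 'y) module_scheme
    \<Rightarrow> ('f \<Rightarrow> 'm) \<Rightarrow> ('a, 'm, 'z) module_scheme \<Rightarrow> bool" where
  "short_exact R K i F p M \<longleftrightarrow>
     mod_hom R K F i \<and> mod_hom R F M p \<and>
     inj_on i (carrier K) \<and>
     mod_hom.im K i = mod_hom.ker F M p \<and>
     mod_hom.im F p = carrier M"

definition S_finite ::
  "('a, 'r) ring_scheme \<Rightarrow> 'a set \<Rightarrow> ('a, 'm, 'x) module_scheme \<Rightarrow> bool" where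
  "S_finite R S M \<longleftrightarrow>
     (\<exists>N s. fg_submodule R N M \<and> s \<in> S \<and> (\<forall>m\<in>carrier M. s \<odot>\<^bsub>M\<^esub> m \<in> N))"

text \<open>
  The carriers of \<^term>\<open>K\<close> and \<^term>\<open>F\<close> below live in \<^typ>\<open>nat \<Rightarrow> 'a\<close>. This loses no generality:
  a finitely generated free module over \<^term>\<open>R\<close> is isomorphic to some \<open>R\<^sup>n\<close>, whose elements
  are functions on \<open>{..<n}\<close>, and \<^term>\<open>K\<close> is isomorphic to its image in \<^term>\<open>F\<close>.
\<close>

definition S_finitely_presented ::
  "('a, 'r) ring_scheme \<Rightarrow> 'a set \<Rightarrow> ('a, 'm, 'x) module_scheme \<Rightarrow> bool" where
  "S_finitely_presented R S M \<longleftrightarrow>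
     (\<exists>(K :: ('a, nat \<Rightarrow> 'a) module) (F :: ('a, nat \<Rightarrow> 'a) module) i p.
        short_exact R K i F p M \<and> S_finite R S K \<and> free_module R F \<and> finitely_generated R F)"

definition S_coherent ::
  "('a, 'r) ring_scheme \<Rightarrow> 'a set \<Rightarrow> ('a, 'm, 'x) module_scheme \<Rightarrow> bool" where
  "S_coherent R S M \<longleftrightarrow> finitely_generated R M \<and>
     (\<forall>N. fg_submodule R N M \<longrightarrow> S_finitely_presented R S (M\<lparr>carrier := N\<rparr>))"

definition S_coherent_ring :: "('a, 'r) ring_scheme \<Rightarrow> 'a set \<Rightarrow> bool" where
  "S_coherent_ring R S \<longleftrightarrow> S_coherent R S (regular_module R)"

definition fg_ideal :: "'a set \<Rightarrow> ('a, 'r) ring_scheme \<Rightarrow> bool" where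
  "fg_ideal I R \<longleftrightarrow> (\<exists>A. finite A \<and> A \<subseteq> carrier R \<and> I = genideal R A)"

definition S_finite_ideal :: "('a, 'r) ring_scheme \<Rightarrow> 'a set \<Rightarrow> 'a set \<Rightarrow> bool" where
  "S_finite_ideal R S I \<longleftrightarrow> ideal I R \<and> S_finite R S ((regular_module R)\<lparr>carrier := I\<rparr>)"

definition residual :: "('a, 'r) ring_scheme \<Rightarrow> 'a set \<Rightarrow> 'a \<Rightarrow> 'a set" where
  "residual R I a = {x \<in> carrier R. x \<otimes>\<^bsub>R\<^esub> a \<in> I}"

text \<open>
  A theorem cannot quantify over types, so "every module" is rendered as "every module whose carrier
  is a set of elements of the type \<open>'m\<close>", where \<open>'m\<close> plays the role of the universe and is itself
  a type variable of the theorem. The only requirement on \<open>'m\<close> is that it has room for a copy of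
  the underlying set of the ring, as given by an injection \<open>emb\<close>: otherwise (say if \<open>'m\<close> has one
  element) there may be no nonzero \<^term>\<open>R\<close>-module in \<open>'m\<close> at all. The choices \<open>'m = 'a\<close> and
  \<open>'m = 'a + 'n\<close> for an arbitrary type \<open>'n\<close> always qualify, so up to isomorphism no module is lost.
\<close>

end

theory Submission
  imports Defs
begin

text \<open>
  Everything is reduced to relation modules of finite families: for \<open>v\<^sub>0, \<dots>, v\<^sub>n\<^sub>-\<^sub>1\<close> generating \<open>M\<close>,
  the module \<open>M\<close> is \<open>S\<close>-finitely presented iff the kernel of \<open>R\<^sup>n \<rightarrow> M\<close> is \<open>S\<close>-finite, whichever
  generators are taken (Schanuel's lemma). Hence \<open>R\<close> is \<open>S\<close>-coherent iff all finite families in \<open>R\<close>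
  have \<open>S\<close>-finite relations. This property passes to \<open>R\<^sup>n\<close> one coordinate at a time, because the
  kernel of a homomorphism from an \<open>S\<close>-finite module to \<open>R\<close> is then \<open>S\<close>-finite, and from \<open>R\<^sup>n\<close> to
  free and to \<open>S\<close>-finitely presented modules. Conversely, the last coordinate maps the relations of
  \<open>u\<^sub>0, \<dots>, u\<^sub>n\<close> in \<open>R\<close> onto \<open>((u\<^sub>0, \<dots>, u\<^sub>n\<^sub>-\<^sub>1) : u\<^sub>n)\<close>, and the kernel of this map is the relation module of
  \<open>u\<^sub>0, \<dots>, u\<^sub>n\<^sub>-\<^sub>1\<close>, so condition 4 gives \<open>S\<close>-coherence by induction on \<open>n\<close>.
\<close>

section \<open>S-finite submodules\<close>

text \<open>Submodules are handled as subsets \<open>U\<close> of one fixed ambient module, and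
  spans are taken in that ambient module, so that subsets, images and kernels can be compared
  without changing carriers.\<close>

definition S_finite_sub ::
  "('a, 'r) ring_scheme \<Rightarrow> 'a set \<Rightarrow> ('a, 'm, 'x) module_scheme \<Rightarrow> 'm set \<Rightarrow> bool" where
  "S_finite_sub R S M U \<longleftrightarrow>
     (\<exists>A s. finite A \<and> A \<subseteq> U \<and> s \<in> S \<and> (\<forall>x\<in>U. s \<odot>\<^bsub>M\<^esub> x \<in> module.span R M A))"

section \<open>Submodules as subsets of an ambient module\<close>

lemma submoduleD:
  assumes "submodule R U M"
  shows "module R M" "U \<subseteq> carrier M" "\<zero>\<^bsub>M\<^esub> \<in> U"
    "\<And>x y. x \<in> U \<Longrightarrow> y \<in> U \<Longrightarrow> x \<oplus>\<^bsub>M\<^esub> y \<in> U"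
    "\<And>a x. a \<in> carrier R \<Longrightarrow> x \<in> U \<Longrightarrow> a \<odot>\<^bsub>M\<^esub> x \<in> U"
  using assms unfolding submodule_def by auto

lemma submodule_minus_closed:
  assumes U: "submodule R U M" and "x \<in> U" "y \<in> U"
  shows "\<ominus>\<^bsub>M\<^esub> x \<in> U" "x \<ominus>\<^bsub>M\<^esub> y \<in> U"
proof -
  interpret module R M by (rule submoduleD(1)[OF U])
  have neg: "\<ominus>\<^bsub>M\<^esub> z \<in> U" if "z \<in> U" for z
    using submoduleD(5)[OF U, of "\<ominus>\<^bsub>R\<^esub> \<one>\<^bsub>R\<^esub>" z] smult_minus_1[of z] that submoduleD(2)[OF U] by auto
  show "\<ominus>\<^bsub>M\<^esub> x \<in> U" by (rule neg) fact
  show "x \<ominus>\<^bsub>M\<^esub> y \<in> U" using neg submoduleD(4)[OF U] assms by (simp add: a_minus_def)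
qed

lemma submodule_carrier: "module R M \<Longrightarrow> submodule R (carrier M) M"
proof -
  assume "module R M"
  then interpret module R M .
  show ?thesis by unfold_locales auto
qed

lemma submodule_is_module: "submodule R U M \<Longrightarrow> module R (M\<lparr>carrier := U\<rparr>)"
  by (frule submoduleD(1)) (rule module.submodule_is_module)

lemma span_carrier_update:
  assumes "submodule R U M" "A \<subseteq> U"
  shows "module.span R (M\<lparr>carrier := U\<rparr>) A = module.span R M A"
  by (rule module.span_li_not_depend(1)[OF submoduleD(1)[OF assms(1)] assms(2,1)])

lemma submodule_carrier_update:
  assumes "submodule R U M"
  shows "submodule R Y (M\<lparr>carrier := U\<rparr>) \<longleftrightarrow> submodule R Y M \<and> Y \<subseteq> U"
  using assms submodule_is_module[OF assms] unfolding submodule_def by auto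

lemma fg_submodule_iff:
  "fg_submodule R N M \<longleftrightarrow>
     submodule R N M \<and> (\<exists>A. finite A \<and> A \<subseteq> N \<and> module.span R M A = N)"
  unfolding fg_submodule_def finitely_generated_def using span_carrier_update[of R N M] by auto

text \<open>Spans do not change when the carrier is restricted to \<open>U\<close>, so a generating
  set of the witness \<open>N\<close> serves on the right. Conversely \<open>span A\<close> stays
  inside the submodule \<open>U\<close> and is the required finitely generated submodule.\<close>

lemma S_finite_iff:
  assumes U: "submodule R U M"
  shows "S_finite R S (M\<lparr>carrier := U\<rparr>) \<longleftrightarrow> S_finite_sub R S M U"
proof
  assume "S_finite R S (M\<lparr>carrier := U\<rparr>)"
  then obtain N s A where "submodule R N (M\<lparr>carrier := U\<rparr>)" "finite A" "A \<subseteq> N"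
    "module.span R (M\<lparr>carrier := U\<rparr>) A = N" "s \<in> S" "\<forall>m\<in>U. s \<odot>\<^bsub>M\<^esub> m \<in> N"
    unfolding S_finite_def fg_submodule_iff by auto
  moreover from this have "A \<subseteq> U" unfolding submodule_carrier_update[OF U] by auto
  ultimately have "finite A \<and> A \<subseteq> U \<and> s \<in> S \<and> (\<forall>x\<in>U. s \<odot>\<^bsub>M\<^esub> x \<in> module.span R M A)"
    using span_carrier_update[OF U] by auto
  then show "S_finite_sub R S M U" unfolding S_finite_sub_def by blast
next
  assume "S_finite_sub R S M U"
  then obtain A s where A: "finite A" "A \<subseteq> U" "s \<in> S" "\<forall>x\<in>U. s \<odot>\<^bsub>M\<^esub> x \<in> module.span R M A"
    unfolding S_finite_sub_def by auto
  interpret module R M by (rule submoduleD(1)[OF U])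
  have A': "A \<subseteq> carrier M" using A(2) submoduleD(2)[OF U] by auto
  have "submodule R (span A) (M\<lparr>carrier := U\<rparr>)"
    unfolding submodule_carrier_update[OF U] using span_is_submodule[OF A'] span_is_subset[OF A(2) U] by auto
  then have "fg_submodule R (span A) (M\<lparr>carrier := U\<rparr>)"
    unfolding fg_submodule_iff using A(1) in_own_span[OF A'] span_carrier_update[OF U A(2)] by (intro conjI exI[of _ A]) auto
  then show "S_finite R S (M\<lparr>carrier := U\<rparr>)"
    unfolding S_finite_def using A(3,4) by auto
qed

section \<open>Homomorphisms, images and preimages of submodules\<close>

lemma mod_homI:
  assumes "module R M" "module R N" "\<And>x. x \<in> carrier M \<Longrightarrow> f x \<in> carrier N"
    "\<And>x y. x \<in> carrier M \<Longrightarrow> y \<in> carrier M \<Longrightarrow> f (x \<oplus>\<^bsub>M\<^esub> y) = f x \<oplus>\<^bsub>N\<^esub> f y"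
    "\<And>a x. a \<in> carrier R \<Longrightarrow> x \<in> carrier M \<Longrightarrow> f (a \<odot>\<^bsub>M\<^esub> x) = a \<odot>\<^bsub>N\<^esub> f x"
  shows "mod_hom R M N f"
  using assms unfolding mod_hom_def mod_hom_axioms_def module_hom_def by auto

lemma mod_hom_comp:
  assumes f: "mod_hom R M N f" and g: "mod_hom R N P g"
  shows "mod_hom R M P (\<lambda>x. g (f x))"
proof -
  interpret f: mod_hom R M N f by fact
  interpret g: mod_hom R N P g by fact
  show ?thesis by (rule mod_homI) (unfold_locales, auto)
qed

lemma submodule_image:
  assumes h: "mod_hom R M N h" and U: "submodule R U M"
  shows "submodule R (h ` U) N"
proof -
  interpret h: mod_hom R M N h by fact
  note U' = submoduleD[OF U]
  have "x \<oplus>\<^bsub>N\<^esub> y \<in> h ` U" if "x \<in> h ` U" "y \<in> h ` U" for x y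
  proof -
    from that obtain a b where "a \<in> U" "b \<in> U" "x = h a" "y = h b" by auto
    then have "x \<oplus>\<^bsub>N\<^esub> y = h (a \<oplus>\<^bsub>M\<^esub> b)" using U'(2) by (subst h.f_add) auto
    then show ?thesis using U'(4) \<open>a \<in> U\<close> \<open>b \<in> U\<close> by auto
  qed
  moreover have "a \<odot>\<^bsub>N\<^esub> x \<in> h ` U" if "a \<in> carrier R" "x \<in> h ` U" for a x
  proof -
    from that obtain b where "b \<in> U" "x = h b" by auto
    then have "a \<odot>\<^bsub>N\<^esub> x = h (a \<odot>\<^bsub>M\<^esub> b)" using U'(2) that by (subst h.f_smult) auto
    then show ?thesis using U'(5) \<open>b \<in> U\<close> that by auto
  qed
  moreover have "\<zero>\<^bsub>N\<^esub> \<in> h ` U" using U'(3) h.f0_is_0 by (metis imageI)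
  ultimately show ?thesis
    unfolding submodule_def using U'(2) h.N.module_axioms by auto
qed

lemma submodule_vimage:
  assumes h: "mod_hom R M N h" and U: "submodule R U M" and Y: "submodule R Y N"
  shows "submodule R {x \<in> U. h x \<in> Y} M"
proof -
  interpret h: mod_hom R M N h by fact
  show ?thesis
    using submoduleD[OF U] submoduleD[OF Y] h.f_add h.f_smult unfolding submodule_def
    by (auto simp: subset_iff)
qed

lemma submodule_zero: "module R M \<Longrightarrow> submodule R {\<zero>\<^bsub>M\<^esub>} M"
proof -
  assume "module R M"
  then interpret module R M .
  show ?thesis by unfold_locales auto
qed

text \<open>Both inclusions are minimality of a span: \<open>A\<close> lies in the preimage of
  \<open>span (h\<close> A)\<open>, and\<close>h \<open>A\<close> lies in the image of
  \<open>span A\<close>, and both of these sets are submodules.\<close>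

lemma span_image:
  assumes h: "mod_hom R M N h" and A: "A \<subseteq> carrier M"
  shows "h ` module.span R M A = module.span R N (h ` A)"
proof
  interpret h: mod_hom R M N h by fact
  have hA: "h ` A \<subseteq> carrier N" using A by auto
  have "submodule R {x \<in> carrier M. h x \<in> h.N.span (h ` A)} M"
    by (rule submodule_vimage[OF h submodule_carrier h.N.span_is_submodule[OF hA]]) (rule h.M.module_axioms)
  then have "h.M.span A \<subseteq> {x \<in> carrier M. h x \<in> h.N.span (h ` A)}"
    using h.N.in_own_span[OF hA] A by (intro h.M.span_is_subset) auto
  then show "h ` h.M.span A \<subseteq> h.N.span (h ` A)" by auto
  show "h.N.span (h ` A) \<subseteq> h ` h.M.span A"
    using h.M.in_own_span[OF A] submodule_image[OF h h.M.span_is_submodule[OF A]]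
    by (intro h.N.span_is_subset) auto
qed

section \<open>Closure properties of S-finiteness\<close>

locale cring_with_mult_subset = cring R for R (structure) +
  fixes S :: "'a set"
  assumes mult_subset: "submonoid S R"
begin

lemma S_closed: "s \<in> S \<Longrightarrow> s \<in> carrier R" "\<one> \<in> S" "s \<in> S \<Longrightarrow> t \<in> S \<Longrightarrow> s \<otimes> t \<in> S"
  using mult_subset unfolding submonoid_def by auto

lemma S_finite_sub_image:
  assumes h: "mod_hom R M N h" and U: "U \<subseteq> carrier M" "S_finite_sub R S M U"
  shows "S_finite_sub R S N (h ` U)"
proof -
  interpret h: mod_hom R M N h by fact
  from U obtain A s where A: "finite A" "A \<subseteq> U" "s \<in> S" "\<And>x. x \<in> U \<Longrightarrow> s \<odot>\<^bsub>M\<^esub> x \<in> h.M.span A"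
    unfolding S_finite_sub_def by auto
  have "s \<odot>\<^bsub>N\<^esub> h x \<in> h.N.span (h ` A)" if "x \<in> U" for x
  proof -
    have "s \<odot>\<^bsub>N\<^esub> h x = h (s \<odot>\<^bsub>M\<^esub> x)" using that U(1) S_closed A(3) by (subst h.f_smult) auto
    then show ?thesis using A(4)[OF that] span_image[OF h] A(2) U(1) by blast
  qed
  then show ?thesis unfolding S_finite_sub_def using A by blast
qed

text \<open>If \<open>s\<close> carries \<open>U\<close> into \<open>Y\<close> and \<open>t\<close>
  carries \<open>Y\<close> into the span of a finite subset of \<open>Y\<close>, then
  \<open>t \<otimes> s\<close> carries \<open>U\<close> into that span. This serves wherever an
  explicit S-finite subset reaches only the \<open>s\<close>-multiples of \<open>U\<close>.\<close>

lemma S_finite_sub_between: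
  assumes M: "module R M" and U: "U \<subseteq> carrier M" and Y: "S_finite_sub R S M Y" "Y \<subseteq> U"
    and s: "s \<in> S" "\<And>x. x \<in> U \<Longrightarrow> s \<odot>\<^bsub>M\<^esub> x \<in> Y"
  shows "S_finite_sub R S M U"
proof -
  interpret M: module R M by fact
  from Y obtain A t where A: "finite A" "A \<subseteq> Y" "t \<in> S" "\<And>x. x \<in> Y \<Longrightarrow> t \<odot>\<^bsub>M\<^esub> x \<in> M.span A"
    unfolding S_finite_sub_def by auto
  have "(t \<otimes> s) \<odot>\<^bsub>M\<^esub> x \<in> M.span A" if "x \<in> U" for x
    using A(4)[OF s(2)[OF that]] that U S_closed A(3) s(1) by (auto simp: M.smult_assoc1)
  then show ?thesis unfolding S_finite_sub_def using A s(1) Y(2) S_closed(3)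
    by (intro exI[of _ A] exI[of _ "t \<otimes> s"]) auto
qed

text \<open>The S-version of the fact that an extension of finitely generated modules is finitely
  generated. Generators of the image are lifted to \<open>A\<close>; then \<open>s x\<close> differs
  from some \<open>y\<close> in \<open>span A\<close> by an element of the kernel, and
  \<open>t\<close> carries this difference into the span of the kernel's set \<open>B\<close>. So
  \<open>t \<otimes> s\<close> works for \<open>A \<union> B\<close>.\<close>

lemma S_finite_sub_extension:
  assumes h: "mod_hom R M N h" and U: "submodule R U M"
    and im: "S_finite_sub R S N (h ` U)" and ker: "S_finite_sub R S M {x \<in> U. h x = \<zero>\<^bsub>N\<^esub>}"
  shows "S_finite_sub R S M U"
proof -
  interpret h: mod_hom R M N h by fact
  note U' = submoduleD[OF U]
  from im obtain A' s where A': "finite A'" "A' \<subseteq> h ` U" and s: "s \<in> S"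
    and im': "\<And>y. y \<in> h ` U \<Longrightarrow> s \<odot>\<^bsub>N\<^esub> y \<in> h.N.span A'"
    unfolding S_finite_sub_def by auto
  from A' obtain A where A: "finite A" "A \<subseteq> U" "h ` A = A'"
    using finite_subset_image[of A' h U] by auto
  from ker obtain B t where B: "finite B" "B \<subseteq> U" and t: "t \<in> S"
    and ker': "\<And>x. x \<in> U \<Longrightarrow> h x = \<zero>\<^bsub>N\<^esub> \<Longrightarrow> t \<odot>\<^bsub>M\<^esub> x \<in> h.M.span B"
    unfolding S_finite_sub_def by auto
  have st: "s \<in> carrier R" "t \<in> carrier R" using s t S_closed by auto
  have AB: "A \<union> B \<subseteq> carrier M" "A \<subseteq> carrier M" using A B U' by auto
  note spAB = submoduleD[OF h.M.span_is_submodule[OF AB(1)]]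
  have "(t \<otimes> s) \<odot>\<^bsub>M\<^esub> x \<in> h.M.span (A \<union> B)" if x: "x \<in> U" for x
  proof -
    have xc: "x \<in> carrier M" using x U' by auto
    have "s \<odot>\<^bsub>N\<^esub> h x \<in> h ` h.M.span A" using im' x span_image[OF h AB(2)] A(3) by auto
    then obtain y where y: "y \<in> h.M.span A" "s \<odot>\<^bsub>N\<^esub> h x = h y" by auto
    have yX: "y \<in> U" using y(1) h.M.span_is_subset[OF A(2) U] by auto
    then have yc: "y \<in> carrier M" using U' by auto
    let ?z = "s \<odot>\<^bsub>M\<^esub> x \<ominus>\<^bsub>M\<^esub> y"
    have "?z \<in> U" using submodule_minus_closed(2)[OF U] yX U'(5) x st by auto
    moreover have "h ?z = \<zero>\<^bsub>N\<^esub>"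
      using xc yc st y(2) h.f_im[OF yc] by (simp del: h.N.M.minus_other_side add: h.N.M.r_neg a_minus_def)
    ultimately have "t \<odot>\<^bsub>M\<^esub> ?z \<in> h.M.span B" by (rule ker')
    then have 1: "t \<odot>\<^bsub>M\<^esub> ?z \<in> h.M.span (A \<union> B)" using h.M.span_is_monotone[of B "A \<union> B"] by auto
    have 2: "t \<odot>\<^bsub>M\<^esub> y \<in> h.M.span (A \<union> B)"
      using h.M.span_is_monotone[of A "A \<union> B"] y(1) spAB(5) st by auto
    have "s \<odot>\<^bsub>M\<^esub> x = ?z \<oplus>\<^bsub>M\<^esub> y"
      using xc yc st by (simp add: a_minus_def h.M.M.a_assoc h.M.M.l_neg)
    then have "(t \<otimes> s) \<odot>\<^bsub>M\<^esub> x = t \<odot>\<^bsub>M\<^esub> ?z \<oplus>\<^bsub>M\<^esub> t \<odot>\<^bsub>M\<^esub> y"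
      using xc yc st by (metis h.M.smult_assoc1 h.M.smult_r_distr h.M.smult_closed h.M.M.minus_closed)
    then show ?thesis using spAB(4)[OF 1 2] by simp
  qed
  then show ?thesis
    unfolding S_finite_sub_def using A B S_closed(3)[OF t s] by (intro exI[of _ "A \<union> B"] exI[of _ "t \<otimes> s"]) auto
qed

text \<open>With \<open>s\<close> for \<open>U\<close> and \<open>t\<close> for \<open>Y\<close>,
  the product \<open>s \<otimes> t\<close> serves both summands because \<open>R\<close> is
  commutative.\<close>

lemma S_finite_sub_sum:
  assumes M: "module R M" and Z: "Z \<subseteq> carrier M" and U: "S_finite_sub R S M U" "U \<subseteq> Z"
    and Y: "S_finite_sub R S M Y" "Y \<subseteq> Z"
    and sum: "\<And>z. z \<in> Z \<Longrightarrow> \<exists>x\<in>U. \<exists>y\<in>Y. z = x \<oplus>\<^bsub>M\<^esub> y"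
  shows "S_finite_sub R S M Z"
proof -
  interpret M: module R M by fact
  from U obtain A s where A: "finite A" "A \<subseteq> U" "s \<in> S" "\<And>x. x \<in> U \<Longrightarrow> s \<odot>\<^bsub>M\<^esub> x \<in> M.span A"
    unfolding S_finite_sub_def by auto
  from Y obtain B t where B: "finite B" "B \<subseteq> Y" "t \<in> S" "\<And>x. x \<in> Y \<Longrightarrow> t \<odot>\<^bsub>M\<^esub> x \<in> M.span B"
    unfolding S_finite_sub_def by auto
  have st: "s \<in> carrier R" "t \<in> carrier R" using A B S_closed by auto
  have AB: "A \<union> B \<subseteq> carrier M" using A B U Y Z by auto
  note spAB = submoduleD[OF M.span_is_submodule[OF AB]]
  have "(s \<otimes> t) \<odot>\<^bsub>M\<^esub> z \<in> M.span (A \<union> B)" if "z \<in> Z" for z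
  proof -
    from sum[OF that] obtain x y where xy: "x \<in> U" "y \<in> Y" "z = x \<oplus>\<^bsub>M\<^esub> y" by auto
    have c: "x \<in> carrier M" "y \<in> carrier M" using xy U Y Z by auto
    have "(s \<otimes> t) \<odot>\<^bsub>M\<^esub> z = (t \<otimes> s) \<odot>\<^bsub>M\<^esub> x \<oplus>\<^bsub>M\<^esub> (s \<otimes> t) \<odot>\<^bsub>M\<^esub> y"
      using c st xy by (simp add: M.smult_r_distr m_comm)
    also have "\<dots> = t \<odot>\<^bsub>M\<^esub> (s \<odot>\<^bsub>M\<^esub> x) \<oplus>\<^bsub>M\<^esub> s \<odot>\<^bsub>M\<^esub> (t \<odot>\<^bsub>M\<^esub> y)"
      using c st by (simp add: M.smult_assoc1)
    also have "\<dots> \<in> M.span (A \<union> B)"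
      using A(4)[OF xy(1)] B(4)[OF xy(2)] M.span_is_monotone[of A "A \<union> B"]
        M.span_is_monotone[of B "A \<union> B"] spAB(4)[OF spAB(5)[OF st(2)] spAB(5)[OF st(1)]] by auto
    finally show ?thesis .
  qed
  then show ?thesis
    unfolding S_finite_sub_def using A B U(2) Y(2) S_closed(3)[OF A(3) B(3)]
    by (intro exI[of _ "A \<union> B"] exI[of _ "s \<otimes> t"]) auto
qed

lemma S_finite_sub_span:
  assumes "module R M" "finite A" "A \<subseteq> carrier M"
  shows "S_finite_sub R S M (module.span R M A)"
proof -
  interpret M: module R M by fact
  note sp = M.span_is_submodule[OF assms(3)]
  show ?thesis unfolding S_finite_sub_def
    using assms(2) M.in_own_span[OF assms(3)] submoduleD(5)[OF sp] S_closed
    by (intro exI[of _ A] exI[of _ "\<one>"]) auto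
qed

end

section \<open>Relations of finite families\<close>

text \<open>
  Recursion instead of \<open>finsum\<close>: the value visibly depends only on the operations of \<open>M\<close>, so that it
  is unchanged when the carrier is restricted to a submodule.
\<close>

primrec lin_comb :: "('a, 'm, 'x) module_scheme \<Rightarrow> (nat \<Rightarrow> 'm) \<Rightarrow> nat \<Rightarrow> (nat \<Rightarrow> 'a) \<Rightarrow> 'm" where
  "lin_comb M v 0 c = \<zero>\<^bsub>M\<^esub>"
| "lin_comb M v (Suc n) c = lin_comb M v n c \<oplus>\<^bsub>M\<^esub> c n \<odot>\<^bsub>M\<^esub> v n"

text \<open>The product of countably many copies of \<open>R\<close>, used as the ambient module of
  all \<open>R^n\<close> and all relation modules. Its elements have the type that
  \<open>S_finitely_presented\<close> prescribes for the kernel and the free module.\<close>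

definition seq_module :: "('a, 'r) ring_scheme \<Rightarrow> ('a, nat \<Rightarrow> 'a) module" where
  "seq_module R =
     \<lparr>carrier = {c. \<forall>i. c i \<in> carrier R}, monoid.mult = (\<lambda>b c i. b i \<otimes>\<^bsub>R\<^esub> c i), one = (\<lambda>i. \<one>\<^bsub>R\<^esub>),
      ring.zero = (\<lambda>i. \<zero>\<^bsub>R\<^esub>), add = (\<lambda>b c i. b i \<oplus>\<^bsub>R\<^esub> c i), module.smult = (\<lambda>a c i. a \<otimes>\<^bsub>R\<^esub> c i)\<rparr>"

text \<open>
  \<open>R\<^sup>n\<close> consists of the sequences that vanish from index \<open>n\<close> on, so all the \<open>R\<^sup>n\<close> are nested
  submodules of one module and the relations of \<open>u\<^sub>0, \<dots>, u\<^sub>n\<^sub>-\<^sub>1\<close> are literally those relations of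
  \<open>u\<^sub>0, \<dots>, u\<^sub>n\<close> whose last coordinate is zero.
\<close>

definition tuples :: "('a, 'r) ring_scheme \<Rightarrow> nat \<Rightarrow> (nat \<Rightarrow> 'a) set" where
  "tuples R n = {c. (\<forall>i. c i \<in> carrier R) \<and> (\<forall>i\<ge>n. c i = \<zero>\<^bsub>R\<^esub>)}"

definition unit_tuple :: "('a, 'r) ring_scheme \<Rightarrow> nat \<Rightarrow> nat \<Rightarrow> 'a" where
  "unit_tuple R i = (\<lambda>j. if j = i then \<one>\<^bsub>R\<^esub> else \<zero>\<^bsub>R\<^esub>)"

definition relations ::
  "('a, 'r) ring_scheme \<Rightarrow> ('a, 'm, 'x) module_scheme \<Rightarrow> (nat \<Rightarrow> 'm) \<Rightarrow> nat \<Rightarrow> (nat \<Rightarrow> 'a) set" where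
  "relations R M v n = {c \<in> tuples R n. lin_comb M v n c = \<zero>\<^bsub>M\<^esub>}"

section \<open>Linear combinations as homomorphisms from sequences\<close>

lemma lin_comb_cong:
  assumes "\<And>i. i < n \<Longrightarrow> v i = w i" "\<And>i. i < n \<Longrightarrow> c i = d i"
  shows "lin_comb M v n c = lin_comb M w n d"
  using assms by (induction n) auto

lemma lin_comb_carrier_update [simp]: "lin_comb (M\<lparr>carrier := U\<rparr>) v n c = lin_comb M v n c"
  by (induction n) auto

lemma relations_carrier_update [simp]: "relations R (M\<lparr>carrier := U\<rparr>) v n = relations R M v n"
  by (simp add: relations_def)

lemma seq_module_simps [simp]:
  "carrier (seq_module R) = {c. \<forall>i. c i \<in> carrier R}" "\<zero>\<^bsub>seq_module R\<^esub> = (\<lambda>i. \<zero>\<^bsub>R\<^esub>)"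
  "b \<oplus>\<^bsub>seq_module R\<^esub> c = (\<lambda>i. b i \<oplus>\<^bsub>R\<^esub> c i)" "a \<odot>\<^bsub>seq_module R\<^esub> c = (\<lambda>i. a \<otimes>\<^bsub>R\<^esub> c i)"
  by (auto simp: seq_module_def)

lemma tuplesD:
  assumes "c \<in> tuples R n"
  shows "c i \<in> carrier R" "i \<ge> n \<Longrightarrow> c i = \<zero>\<^bsub>R\<^esub>" "c \<in> carrier (seq_module R)"
  using assms by (auto simp: tuples_def)

lemma lin_comb_closed:
  assumes U: "submodule R U M" and v: "v \<in> {..<n} \<rightarrow> U" and c: "\<And>i. i < n \<Longrightarrow> c i \<in> carrier R"
  shows "lin_comb M v n c \<in> U"
  using v c by (induction n) (auto simp: Pi_iff intro!: submoduleD[OF U])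

lemma lin_comb_hom:
  assumes h: "mod_hom R M N h" and v: "v \<in> {..<n} \<rightarrow> carrier M" and c: "\<And>i. i < n \<Longrightarrow> c i \<in> carrier R"
  shows "h (lin_comb M v n c) = lin_comb N (\<lambda>i. h (v i)) n c"
proof -
  interpret h: mod_hom R M N h by fact
  show ?thesis using v c
  proof (induction n)
    case (Suc n)
    have "lin_comb M v n c \<in> carrier M"
      by (rule lin_comb_closed[OF submodule_carrier]) (use Suc.prems h.M.module_axioms in auto)
    then show ?case using Suc by (auto simp: Pi_iff)
  qed auto
qed

context cring
begin

lemma module_seq_module: "module R (seq_module R)"
proof (rule module_criteria)
  show "\<forall>c\<in>carrier (seq_module R). \<exists>d\<in>carrier (seq_module R).
      c \<oplus>\<^bsub>seq_module R\<^esub> d = \<zero>\<^bsub>seq_module R\<^esub>"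
  proof
    fix c assume "c \<in> carrier (seq_module R)"
    then show "\<exists>d\<in>carrier (seq_module R). c \<oplus>\<^bsub>seq_module R\<^esub> d = \<zero>\<^bsub>seq_module R\<^esub>"
      by (intro bexI[of _ "\<lambda>i. \<ominus> c i"]) (auto simp: r_neg)
  qed
qed (auto simp: is_cring m_assoc l_distr r_distr a_ac)

lemma submodule_tuples: "submodule R (tuples R n) (seq_module R)"
  using module_seq_module unfolding submodule_def tuples_def by auto

text \<open>The domain is the module of all sequences, since only the first \<open>n\<close> entries
  enter the value; the map can then be applied to any submodule of sequences, in particular to
  \<open>tuples R n\<close>.\<close>

lemma mod_hom_lin_comb:
  assumes M: "module R M" and v: "v \<in> {..<n} \<rightarrow> carrier M"
  shows "mod_hom R (seq_module R) M (lin_comb M v n)"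
proof -
  interpret M: module R M by fact
  have cl: "lin_comb M v n c \<in> carrier M"
    if "v \<in> {..<n} \<rightarrow> carrier M" "\<And>i. c i \<in> carrier R" for n and c
    using that by (intro lin_comb_closed[OF submodule_carrier[OF M]]) auto
  have add: "lin_comb M v n (\<lambda>i. b i \<oplus> c i) = lin_comb M v n b \<oplus>\<^bsub>M\<^esub> lin_comb M v n c"
    if "\<And>i. b i \<in> carrier R" "\<And>i. c i \<in> carrier R" for b c
    using v
  proof (induction n)
    case (Suc n)
    have 1: "lin_comb M v n b \<in> carrier M" "lin_comb M v n c \<in> carrier M"
      using Suc.prems that by (auto intro!: cl)
    show ?case using Suc 1 that by (auto simp: Pi_iff M.smult_l_distr M.a_ac)
  qed auto
  have smult: "lin_comb M v n (\<lambda>i. a \<otimes> c i) = a \<odot>\<^bsub>M\<^esub> lin_comb M v n c"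
    if "a \<in> carrier R" "\<And>i. c i \<in> carrier R" for a c
    using v
  proof (induction n)
    case (Suc n)
    have 1: "lin_comb M v n c \<in> carrier M"
      using Suc.prems that by (auto intro!: cl)
    show ?case using Suc 1 that by (auto simp: Pi_iff M.smult_r_distr M.smult_assoc1)
  qed (use that in auto)
  show ?thesis
    by (rule mod_homI[OF module_seq_module M]) (use cl[OF v] add smult in auto)
qed

lemma unit_tuple_in_tuples: "i < n \<Longrightarrow> unit_tuple R i \<in> tuples R n"
  by (auto simp: unit_tuple_def tuples_def)

lemma lin_comb_zero:
  assumes M: "module R M" and v: "v \<in> {..<n} \<rightarrow> carrier M" and c: "\<And>i. i < n \<Longrightarrow> c i = \<zero>"
  shows "lin_comb M v n c = \<zero>\<^bsub>M\<^esub>"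
proof -
  interpret M: module R M by fact
  show ?thesis using v c by (induction n) (auto simp: Pi_iff)
qed

lemma lin_comb_unit_tuple:
  assumes M: "module R M" and v: "v \<in> {..<n} \<rightarrow> carrier M" and "i < n"
  shows "lin_comb M v n (unit_tuple R i) = v i"
proof -
  interpret M: module R M by fact
  show ?thesis using v \<open>i < n\<close>
  proof (induction n)
    case (Suc n)
    have v: "v \<in> {..<n} \<rightarrow> carrier M" "v n \<in> carrier M" using Suc.prems by auto
    show ?case
    proof (cases "i = n")
      case True
      have "lin_comb M v n (unit_tuple R i) = \<zero>\<^bsub>M\<^esub>"
        by (rule lin_comb_zero[OF M v(1)]) (auto simp: unit_tuple_def True)
      then show ?thesis using v True by (simp add: unit_tuple_def)
    next
      case False
      then have "i < n" using Suc.prems by auto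
      moreover have "v i \<in> carrier M" using Suc.prems by auto
      ultimately show ?thesis using Suc.IH[OF v(1)] v False by (simp add: unit_tuple_def)
    qed
  qed auto
qed

text \<open>Turns spans into images of \<open>R^n\<close>. The harder inclusion holds because the
  image is a submodule and contains each \<open>v i\<close> as the value at a unit tuple.\<close>

lemma lin_comb_image:
  assumes M: "module R M" and v: "v \<in> {..<n} \<rightarrow> carrier M"
  shows "lin_comb M v n ` tuples R n = module.span R M (v ` {..<n})"
proof
  interpret M: module R M by fact
  have vc: "v ` {..<n} \<subseteq> carrier M" using v by auto
  show "lin_comb M v n ` tuples R n \<subseteq> M.span (v ` {..<n})"
    using M.in_own_span[OF vc] tuplesD(1)
    by (auto intro!: lin_comb_closed[OF M.span_is_submodule[OF vc]])
  have "v i \<in> lin_comb M v n ` tuples R n" if "i < n" for i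
    using lin_comb_unit_tuple[OF M v that] unit_tuple_in_tuples[OF that] by (metis imageI)
  then show "M.span (v ` {..<n}) \<subseteq> lin_comb M v n ` tuples R n"
    by (intro M.span_is_subset submodule_image[OF mod_hom_lin_comb[OF M v] submodule_tuples]) auto
qed

lemma lin_comb_unit_tuples:
  assumes "c \<in> tuples R n"
  shows "lin_comb (seq_module R) (unit_tuple R) n c = c"
proof -
  \<comment> \<open>The induction runs over the number \<open>m\<close> of summands with
    \<open>c\<close> fixed: the partial sum is \<open>c\<close> cut off at \<open>m\<close>. At
    \<open>m = n\<close> nothing is lost, since \<open>c\<close> vanishes from \<open>n\<close>
    on.\<close>
  have "lin_comb (seq_module R) (unit_tuple R) m c = (\<lambda>i. if i < m then c i else \<zero>)" for m
    using tuplesD(1)[OF assms] by (induction m) (auto simp: unit_tuple_def fun_eq_iff less_Suc_eq)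
  then show ?thesis using tuplesD(2)[OF assms] by (auto simp: fun_eq_iff)
qed

lemma tuples_eq_span:
  "tuples R n = module.span R (seq_module R) (unit_tuple R ` {..<n})"
proof -
  have "unit_tuple R \<in> {..<n} \<rightarrow> carrier (seq_module R)"
    by (auto simp: unit_tuple_def)
  from lin_comb_image[OF module_seq_module this] show ?thesis
    using lin_comb_unit_tuples by (metis (no_types, lifting) image_cong image_ident)
qed

lemma submodule_relations:
  assumes M: "module R M" and v: "v \<in> {..<n} \<rightarrow> carrier M"
  shows "submodule R (relations R M v n) (seq_module R)"
  using submodule_vimage[OF mod_hom_lin_comb[OF M v] submodule_tuples submodule_zero[OF M], of n]
  by (simp add: relations_def)

lemma mod_hom_minus:
  assumes f: "mod_hom R M N f" and g: "mod_hom R M N g"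
  shows "mod_hom R M N (\<lambda>x. f x \<ominus>\<^bsub>N\<^esub> g x)"
proof -
  interpret f: mod_hom R M N f by fact
  interpret g: mod_hom R M N g by fact
  show ?thesis
  proof (rule mod_homI)
    fix x y assume "x \<in> carrier M" "y \<in> carrier M"
    then show "f (x \<oplus>\<^bsub>M\<^esub> y) \<ominus>\<^bsub>N\<^esub> g (x \<oplus>\<^bsub>M\<^esub> y) = f x \<ominus>\<^bsub>N\<^esub> g x \<oplus>\<^bsub>N\<^esub> (f y \<ominus>\<^bsub>N\<^esub> g y)"
      using f.f_im g.f_im by (simp add: a_minus_def f.N.M.minus_add f.N.M.a_ac)
  next
    fix a x assume "a \<in> carrier R" "x \<in> carrier M"
    then show "f (a \<odot>\<^bsub>M\<^esub> x) \<ominus>\<^bsub>N\<^esub> g (a \<odot>\<^bsub>M\<^esub> x) = a \<odot>\<^bsub>N\<^esub> (f x \<ominus>\<^bsub>N\<^esub> g x)"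
      using f.f_im g.f_im by (simp add: a_minus_def f.N.smult_r_distr f.N.smult_r_minus)
  qed (unfold_locales, use f.f_im g.f_im in auto)
qed

lemma mod_hom_id: "module R M \<Longrightarrow> mod_hom R M M (\<lambda>x. x)"
  by (rule mod_homI) (auto simp: module_def)

end

text \<open>Coherence expressed by families instead of submodules. The set \<open>Y\<close> is a
  parameter so that the property can be stated for a part of \<open>M\<close>, such as
  \<open>tuples R n\<close> inside the module of sequences.\<close>

definition S_finite_relations ::
  "('a, 'r) ring_scheme \<Rightarrow> 'a set \<Rightarrow> ('a, 'm, 'x) module_scheme \<Rightarrow> 'm set \<Rightarrow> bool" where
  "S_finite_relations R S M Y \<longleftrightarrow>
     (\<forall>n. \<forall>v\<in>{..<n} \<rightarrow> Y. S_finite_sub R S (seq_module R) (relations R M v n))"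

lemma finite_obtain_family:
  assumes "finite A"
  obtains n and v :: "nat \<Rightarrow> 'a" where "A = v ` {..<n}" "inj_on v {..<n}"
  using finite_imp_nat_seg_image_inj_on[OF assms] by (auto simp: lessThan_def)

section \<open>S-finite kernels and independence of the generators\<close>

context cring_with_mult_subset
begin

lemma S_finite_sub_tuples: "S_finite_sub R S (seq_module R) (tuples R n)"
  unfolding tuples_eq_span by (rule S_finite_sub_span[OF module_seq_module]) (auto simp: unit_tuple_def)

text \<open>Let \<open>w\<close> generate \<open>U\<close> up to \<open>s\<close>. If
  \<open>x\<close> is in the kernel, then \<open>s x\<close> is a combination of \<open>w\<close>
  whose coefficients form a relation of the family \<open>h (w i)\<close>. So the S-finite image of
  this relation module lies in the kernel and contains all its \<open>s\<close>-multiples.\<close>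

lemma S_finite_sub_kernel:
  assumes h: "mod_hom R F M h" and U: "submodule R U F" "S_finite_sub R S F U"
    and hU: "h ` U \<subseteq> Y" and Y: "S_finite_relations R S M Y"
  shows "S_finite_sub R S F {x \<in> U. h x = \<zero>\<^bsub>M\<^esub>}"
proof -
  interpret h: mod_hom R F M h by fact
  from U(2) obtain A s where A: "finite A" "A \<subseteq> U" and s: "s \<in> S"
    and sU: "\<And>x. x \<in> U \<Longrightarrow> s \<odot>\<^bsub>F\<^esub> x \<in> h.M.span A"
    unfolding S_finite_sub_def by auto
  from finite_obtain_family[OF A(1)] obtain m and w :: "nat \<Rightarrow> _" where w: "A = w ` {..<m}" .
  have wU: "w \<in> {..<m} \<rightarrow> U" using A w by auto
  then have wc: "w \<in> {..<m} \<rightarrow> carrier F" using submoduleD(2)[OF U(1)] by auto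
  let ?L = "lin_comb F w m" and ?Z = "relations R M (\<lambda>i. h (w i)) m"
  have L: "mod_hom R (seq_module R) F ?L" by (rule mod_hom_lin_comb[OF h.M.module_axioms wc])
  have hL: "h (?L c) = lin_comb M (\<lambda>i. h (w i)) m c" if "c \<in> tuples R m" for c
    by (rule lin_comb_hom[OF h wc]) (use tuplesD(1)[OF that] in auto)
  have LU: "?L c \<in> U" if "c \<in> tuples R m" for c
    by (rule lin_comb_closed[OF U(1) wU]) (use tuplesD(1)[OF that] in auto)
  have Zc: "?Z \<subseteq> carrier (seq_module R)" using tuplesD(3) unfolding relations_def by blast
  have "(\<lambda>i. h (w i)) \<in> {..<m} \<rightarrow> Y" using wU hU by auto
  then have "S_finite_sub R S (seq_module R) ?Z" using Y unfolding S_finite_relations_def by blast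
  then have SZ: "S_finite_sub R S F (?L ` ?Z)" by (rule S_finite_sub_image[OF L Zc])
  show ?thesis
  proof (rule S_finite_sub_between[OF h.M.module_axioms _ SZ _ s])
    show "{x \<in> U. h x = \<zero>\<^bsub>M\<^esub>} \<subseteq> carrier F" using submoduleD(2)[OF U(1)] by auto
    show "?L ` ?Z \<subseteq> {x \<in> U. h x = \<zero>\<^bsub>M\<^esub>}"
      using hL LU by (auto simp: relations_def)
    fix x assume x: "x \<in> {x \<in> U. h x = \<zero>\<^bsub>M\<^esub>}"
    then have "s \<odot>\<^bsub>F\<^esub> x \<in> ?L ` tuples R m"
      using sU lin_comb_image[OF h.M.module_axioms wc] w by auto
    then obtain b where b: "b \<in> tuples R m" "s \<odot>\<^bsub>F\<^esub> x = ?L b" by auto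
    have "h (s \<odot>\<^bsub>F\<^esub> x) = \<zero>\<^bsub>M\<^esub>" using x s S_closed(1) submoduleD(2)[OF U(1)] by auto
    then have "b \<in> ?Z" using b hL[OF b(1)] by (auto simp: relations_def)
    then show "s \<odot>\<^bsub>F\<^esub> x \<in> ?L ` ?Z" using b by auto
  qed
qed

text \<open>Schanuel's lemma, in the form that \<open>S\<close>-finiteness of the relation module does not depend
  on the generating family: if the matrices \<open>D\<close>, \<open>A\<close> express \<open>v\<close> by \<open>w\<close> and \<open>w\<close> by \<open>v\<close>, a
  relation \<open>z\<close> of \<open>w\<close> splits into \<open>D (A z)\<close>, where \<open>A z\<close> is a relation of \<open>v\<close>, and \<open>z - D (A z)\<close>.\<close>

lemma S_finite_sub_relations_change_generators:
  assumes M: "module R M" and v: "v \<in> {..<n} \<rightarrow> carrier M" and w: "w \<in> {..<k} \<rightarrow> carrier M"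
    and vgen: "w ` {..<k} \<subseteq> lin_comb M v n ` tuples R n"
    and wgen: "v ` {..<n} \<subseteq> lin_comb M w k ` tuples R k"
    and fin: "S_finite_sub R S (seq_module R) (relations R M v n)"
  shows "S_finite_sub R S (seq_module R) (relations R M w k)"
proof -
  let ?P = "seq_module R"
  interpret M: module R M by fact
  interpret P: module R ?P by (rule module_seq_module)
  have "\<forall>i\<in>{..<n}. \<exists>d. d \<in> tuples R k \<and> lin_comb M w k d = v i" using wgen by force
  then obtain D where D: "\<And>i. i < n \<Longrightarrow> D i \<in> tuples R k \<and> lin_comb M w k (D i) = v i"
    by (metis lessThan_iff)
  have "\<forall>i\<in>{..<k}. \<exists>d. d \<in> tuples R n \<and> lin_comb M v n d = w i" using vgen by force
  then obtain A where A: "\<And>i. i < k \<Longrightarrow> A i \<in> tuples R n \<and> lin_comb M v n (A i) = w i"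
    by (metis lessThan_iff)
  have Dc: "D \<in> {..<n} \<rightarrow> tuples R k" "D \<in> {..<n} \<rightarrow> carrier ?P"
    and Ac: "A \<in> {..<k} \<rightarrow> tuples R n" "A \<in> {..<k} \<rightarrow> carrier ?P"
    using D A tuplesD(3) by blast+
  let ?f = "lin_comb ?P D n" and ?g = "lin_comb ?P A k"
  note f = mod_hom_lin_comb[OF module_seq_module Dc(2)]
  note g = mod_hom_lin_comb[OF module_seq_module Ac(2)]
  have ft: "?f c \<in> tuples R k" if "c \<in> tuples R n" for c
    by (rule lin_comb_closed[OF submodule_tuples Dc(1)]) (use that tuplesD in auto)
  have gt: "?g c \<in> tuples R n" if "c \<in> tuples R k" for c
    by (rule lin_comb_closed[OF submodule_tuples Ac(1)]) (use that tuplesD in auto)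
  have wf: "lin_comb M w k (?f c) = lin_comb M v n c" if "c \<in> tuples R n" for c
    using lin_comb_hom[OF mod_hom_lin_comb[OF M w] Dc(2), of c] tuplesD(1)[OF that] D
    by (simp cong: lin_comb_cong)
  have vg: "lin_comb M v n (?g c) = lin_comb M w k c" if "c \<in> tuples R k" for c
    using lin_comb_hom[OF mod_hom_lin_comb[OF M v] Ac(2), of c] tuplesD(1)[OF that] A
    by (simp cong: lin_comb_cong)
  let ?h = "\<lambda>c. c \<ominus>\<^bsub>?P\<^esub> ?f (?g c)"
  have h: "mod_hom R ?P ?P ?h"
    by (rule mod_hom_minus[OF mod_hom_id[OF module_seq_module] mod_hom_comp[OF g f]])
  interpret w: mod_hom R ?P M "lin_comb M w k" by (rule mod_hom_lin_comb[OF M w])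
  have sub: "relations R M v n \<subseteq> carrier ?P" "tuples R k \<subseteq> carrier ?P" "relations R M w k \<subseteq> carrier ?P"
    using tuplesD(3) unfolding relations_def by blast+
  show ?thesis
  proof (rule S_finite_sub_sum[OF module_seq_module sub(3) S_finite_sub_image[OF f sub(1) fin] _
        S_finite_sub_image[OF h sub(2) S_finite_sub_tuples]])
    show "?f ` relations R M v n \<subseteq> relations R M w k"
      using ft wf by (auto simp: relations_def)
    show "?h ` tuples R k \<subseteq> relations R M w k"
    proof
      fix x assume "x \<in> ?h ` tuples R k"
      then obtain c where c: "c \<in> tuples R k" "x = ?h c" by auto
      have "x \<in> tuples R k"
        unfolding c(2) by (rule submodule_minus_closed[OF submodule_tuples c(1) ft[OF gt[OF c(1)]]])
      moreover have "lin_comb M w k x = lin_comb M w k c \<ominus>\<^bsub>M\<^esub> lin_comb M w k (?f (?g c))"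
        unfolding c(2) by (rule w.f_minus) (use tuplesD(3) c ft gt in blast)+
      ultimately show "x \<in> relations R M w k"
        using wf[OF gt[OF c(1)]] vg[OF c(1)] w.f_im[OF tuplesD(3)[OF c(1)]] by (simp add: relations_def)
    qed
    fix z assume "z \<in> relations R M w k"
    then have z: "z \<in> tuples R k" "lin_comb M w k z = \<zero>\<^bsub>M\<^esub>" by (auto simp: relations_def)
    have "?g z \<in> relations R M v n" using gt[OF z(1)] vg[OF z(1)] z(2) by (simp add: relations_def)
    moreover have "z = ?f (?g z) \<oplus>\<^bsub>?P\<^esub> ?h z"
      using tuplesD(3)[OF z(1)] tuplesD(3)[OF ft[OF gt[OF z(1)]]]
      by (metis P.M.a_comm P.M.minus_closed P.M.minus_eq P.M.r_neg1 P.M.add.inv_closed P.M.a_lcomm)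
    ultimately show "\<exists>x\<in>?f ` relations R M v n. \<exists>y\<in>?h ` tuples R k. z = x \<oplus>\<^bsub>?P\<^esub> y"
      using z(1) by blast
  qed
qed

end

lemma lin_comb_add:
  "lin_comb M v (k + q) c = lin_comb M v k c \<oplus>\<^bsub>M\<^esub> lin_comb M (\<lambda>i. v (k + i)) q (\<lambda>i. c (k + i))"
  if M: "module R M" and v: "v \<in> {..<k + q} \<rightarrow> carrier M" and c: "\<And>i. c i \<in> carrier R"
proof -
  interpret M: module R M by fact
  show ?thesis using v
  proof (induction q)
    case 0
    then have "lin_comb M v k c \<in> carrier M"
      using c by (intro lin_comb_closed[OF submodule_carrier[OF M]]) auto
    then show ?case by simp
  next
    case (Suc q)
    have 1: "lin_comb M v k c \<in> carrier M"
      using c Suc.prems by (intro lin_comb_closed[OF submodule_carrier[OF M]]) auto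
    have 2: "lin_comb M (\<lambda>i. v (k + i)) q (\<lambda>i. c (k + i)) \<in> carrier M"
      using c Suc.prems by (intro lin_comb_closed[OF submodule_carrier[OF M]]) auto
    have 3: "c (k + q) \<odot>\<^bsub>M\<^esub> v (k + q) \<in> carrier M" using c Suc.prems by auto
    have "v \<in> {..<k + q} \<rightarrow> carrier M" using Suc.prems by auto
    from Suc.IH[OF this] show ?case using 1 2 3 by (simp add: M.M.a_assoc)
  qed
qed

section \<open>Coordinate maps, inverse homomorphisms and free modules\<close>

context cring
begin

lemma mod_hom_truncate:
  "mod_hom R (seq_module R) (seq_module R) (\<lambda>c i. if i < k then c i else \<zero>)"
  by (rule mod_homI[OF module_seq_module module_seq_module]) (auto simp: fun_eq_iff)

lemma mod_hom_coordinate: "mod_hom R (seq_module R) (regular_module R) (\<lambda>c. c i)"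
  by (rule mod_homI[OF module_seq_module module_regular_module]) (auto simp: regular_module_def)

lemma inj_on_if_trivial_kernel:
  assumes h: "mod_hom R M N h" and U: "submodule R U M"
    and ker: "\<And>x. x \<in> U \<Longrightarrow> h x = \<zero>\<^bsub>N\<^esub> \<Longrightarrow> x = \<zero>\<^bsub>M\<^esub>"
  shows "inj_on h U"
proof (rule inj_onI)
  interpret h: mod_hom R M N h by fact
  fix x y assume xy: "x \<in> U" "y \<in> U" "h x = h y"
  have c: "x \<in> carrier M" "y \<in> carrier M" using xy submoduleD(2)[OF U] by auto
  have "h (x \<ominus>\<^bsub>M\<^esub> y) = \<zero>\<^bsub>N\<^esub>" using c xy(3) h.f_im[OF c(2)] by simp
  from ker[OF submodule_minus_closed(2)[OF U xy(1,2)] this] show "x = y" using c by simp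
qed

text \<open>The bijection is assumed on a submodule \<open>U\<close> because \<open>lin_comb\<close>
  is a homomorphism on all sequences but can be bijective only on \<open>tuples R n\<close>. The
  inverse gives the coordinates with respect to a basis.\<close>

lemma mod_hom_inv_into:
  assumes h: "mod_hom R M N h" and U: "submodule R U M" and bij: "bij_betw h U (carrier N)"
  shows "mod_hom R N M (inv_into U h)"
proof -
  interpret h: mod_hom R M N h by fact
  note U' = submoduleD[OF U]
  have inj: "inj_on h U" and im: "h ` U = carrier N" using bij by (auto simp: bij_betw_def)
  have g: "inv_into U h y \<in> U" "h (inv_into U h y) = y" if "y \<in> carrier N" for y
    using that im by (auto simp: inv_into_into f_inv_into_f)
  show ?thesis
  proof (rule mod_homI)
    fix x y assume xy: "x \<in> carrier N" "y \<in> carrier N"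
    have "h (inv_into U h x \<oplus>\<^bsub>M\<^esub> inv_into U h y) = x \<oplus>\<^bsub>N\<^esub> y"
      using g[OF xy(1)] g[OF xy(2)] U'(2) by (subst h.f_add) auto
    then show "inv_into U h (x \<oplus>\<^bsub>N\<^esub> y) = inv_into U h x \<oplus>\<^bsub>M\<^esub> inv_into U h y"
      using g[OF xy(1)] g[OF xy(2)] U'(4) by (metis inv_into_f_f[OF inj])
  next
    fix a x assume ax: "a \<in> carrier R" "x \<in> carrier N"
    have "h (a \<odot>\<^bsub>M\<^esub> inv_into U h x) = a \<odot>\<^bsub>N\<^esub> x"
      using g[OF ax(2)] U'(2) ax by (subst h.f_smult) auto
    then show "inv_into U h (a \<odot>\<^bsub>N\<^esub> x) = a \<odot>\<^bsub>M\<^esub> inv_into U h x"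
      using g[OF ax(2)] U'(5)[OF ax(1)] by (metis inv_into_f_f[OF inj])
  qed (use g U'(2) h.M.module_axioms h.N.module_axioms in auto)
qed

text \<open>The bridge to \<open>lin_dep\<close>, which is about sums over sets. Injectivity ensures
  that a vector occurring twice in the family is not counted once in the set.\<close>

lemma lincomb_image_family:
  assumes M: "module R M" and v: "v \<in> {..<n} \<rightarrow> carrier M" "inj_on v {..<n}"
    and a: "\<And>i. i < n \<Longrightarrow> a (v i) \<in> carrier R"
  shows "module.lincomb M a (v ` {..<n}) = lin_comb M v n (\<lambda>i. a (v i))"
proof -
  interpret M: module R M by fact
  show ?thesis using v a
  proof (induction n)
    case 0
    then show ?case by (simp add: M.lincomb_def)
  next
    case (Suc n)
    have v: "v \<in> {..<n} \<rightarrow> carrier M" "inj_on v {..<n}" "v n \<in> carrier M"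
      using Suc.prems by (auto simp: inj_on_def)
    have "v n \<notin> v ` {..<n}" using inj_onD[OF Suc.prems(2), of n] by fastforce
    then have "M.lincomb a (v ` {..<n} \<union> {v n}) = a (v n) \<odot>\<^bsub>M\<^esub> v n \<oplus>\<^bsub>M\<^esub> M.lincomb a (v ` {..<n})"
      using v Suc.prems(3) by (intro M.lincomb_insert) auto
    moreover have "v ` {..<Suc n} = v ` {..<n} \<union> {v n}" by (auto simp: less_Suc_eq)
    moreover have "lin_comb M v n (\<lambda>i. a (v i)) \<in> carrier M"
      using v Suc.prems by (intro lin_comb_closed[OF submodule_carrier[OF M]]) auto
    ultimately show ?case using Suc v by (simp add: M.M.a_comm)
  qed
qed

text \<open>The set of values of \<open>v\<close> is a basis: a linear dependence among them would
  give a nonzero relation of the family.\<close>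

lemma free_moduleI:
  assumes M: "module R M" and v: "v \<in> {..<n} \<rightarrow> carrier M"
    and gen: "lin_comb M v n ` tuples R n = carrier M"
    and rel: "relations R M v n \<subseteq> {\<lambda>i. \<zero>}"
  shows "free_module R M"
proof -
  interpret M: module R M by fact
  let ?B = "v ` {..<n}"
  have B: "?B \<subseteq> carrier M" using v by auto
  have "\<not> M.lin_dep ?B"
  proof
    assume "M.lin_dep ?B"
    from M.finite_lin_dep[OF _ this B] obtain a j
      where a: "a \<in> ?B \<rightarrow> carrier R" "M.lincomb a ?B = \<zero>\<^bsub>M\<^esub>" and j: "j < n" "a (v j) \<noteq> \<zero>"
      by auto
    \<comment> \<open>If \<open>v i = v k\<close> with \<open>i \<noteq> k\<close>, the difference
      of two unit tuples is a relation, hence zero, and \<open>\<one> = \<zero>\<close>. This is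
      possible over the zero ring, so injectivity is proved inside the refutation, where the nonzero
      coefficient \<open>a (v j)\<close> rules that ring out.\<close>
    have "inj_on v {..<n}"
    proof (rule inj_onI, rule ccontr)
      fix i k assume ik: "i \<in> {..<n}" "k \<in> {..<n}" "v i = v k" "i \<noteq> k"
      interpret L: mod_hom R "seq_module R" M "lin_comb M v n" by (rule mod_hom_lin_comb[OF M v])
      let ?c = "unit_tuple R i \<ominus>\<^bsub>seq_module R\<^esub> unit_tuple R k"
      have u: "unit_tuple R i \<in> tuples R n" "unit_tuple R k \<in> tuples R n"
        using ik unit_tuple_in_tuples by auto
      have "lin_comb M v n ?c = \<zero>\<^bsub>M\<^esub>"
        using L.f_minus[OF tuplesD(3)[OF u(1)] tuplesD(3)[OF u(2)]] lin_comb_unit_tuple[OF M v] ik B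
        by (auto simp: image_subset_iff)
      then have "?c = \<zero>\<^bsub>seq_module R\<^esub>"
        using rel submodule_minus_closed(2)[OF submodule_tuples u] by (auto simp: relations_def)
      then have "unit_tuple R i = unit_tuple R k"
        using tuplesD(3)[OF u(1)] tuplesD(3)[OF u(2)] by (simp only: L.M.M.minus_other_side)
      then have "unit_tuple R i i = unit_tuple R k i" by simp
      then have "\<one> = \<zero>" using ik by (simp add: unit_tuple_def)
      moreover have "a (v j) \<in> carrier R" using a j by auto
      ultimately show False using j by (metis l_null l_one)
    qed
    have "a (v i) \<in> carrier R" if "i < n" for i using a(1) that by auto
    from lincomb_image_family[where a = a, OF M v \<open>inj_on v {..<n}\<close> this] a(2)
    have 0: "lin_comb M v n (\<lambda>i. a (v i)) = \<zero>\<^bsub>M\<^esub>" by simp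
    \<comment> \<open>Nothing is known about \<open>a (v i)\<close> from index \<open>n\<close> on;
      cutting off there produces an element of \<open>tuples R n\<close>.\<close>
    let ?c = "\<lambda>i. if i < n then a (v i) else \<zero>"
    have "lin_comb M v n ?c = lin_comb M v n (\<lambda>i. a (v i))" by (rule lin_comb_cong) auto
    then have "?c \<in> relations R M v n" using 0 a(1) by (auto simp: relations_def tuples_def)
    then have "?c = (\<lambda>i. \<zero>)" using rel by blast
    then have "?c j = \<zero>" by metis
    then show False using j by simp
  qed
  then show ?thesis unfolding free_module_def using M B gen lin_comb_image[OF M v] by metis
qed

text \<open>\<open>F\<close> may have infinite rank, but each element of the finite set
  \<open>A\<close> is a combination of finitely many basis elements. These form the family
  \<open>b\<close>, and a subset of a basis is still linearly independent.\<close>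

lemma free_module_finite_basis:
  assumes F: "free_module R F" and A: "finite A" "A \<subseteq> carrier F"
  obtains n and b where "b \<in> {..<n} \<rightarrow> carrier F" "relations R F b n = {\<lambda>i. \<zero>}"
    "A \<subseteq> lin_comb F b n ` tuples R n"
proof -
  interpret F: module R F using F by (simp add: free_module_def)
  from F obtain B where B: "B \<subseteq> carrier F" "\<not> F.lin_dep B" "F.span B = carrier F"
    unfolding free_module_def by auto
  have "\<exists>C. finite C \<and> C \<subseteq> B \<and> A \<subseteq> F.span C"
    using A
  proof (induction A rule: finite_induct)
    case (insert x A)
    then obtain C where C: "finite C" "C \<subseteq> B" "A \<subseteq> F.span C" by auto
    have "x \<in> F.span B" using insert.prems B(3) by auto
    then obtain D where D: "finite D" "D \<subseteq> B" "x \<in> F.span D" unfolding F.span_def by blast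
    show ?case using C D F.span_is_monotone[of C "C \<union> D"] F.span_is_monotone[of D "C \<union> D"]
      by (intro exI[of _ "C \<union> D"]) auto
  qed auto
  then obtain C where C: "finite C" "C \<subseteq> B" "A \<subseteq> F.span C" by auto
  from finite_obtain_family[OF C(1)] obtain n and b :: "nat \<Rightarrow> _"
    where b: "C = b ` {..<n}" "inj_on b {..<n}" .
  have bc: "b \<in> {..<n} \<rightarrow> carrier F" using b C B by auto
  have "c = (\<lambda>i. \<zero>)" if "c \<in> relations R F b n" for c
  proof (rule ext, rule ccontr)
    fix i assume i: "c i \<noteq> \<zero>"
    have c: "c \<in> tuples R n" "lin_comb F b n c = \<zero>\<^bsub>F\<^esub>" using that by (auto simp: relations_def)
    then have "i < n" using i tuplesD(2) by (metis not_le)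
    \<comment> \<open>Coefficients indexed by positions become coefficients indexed by vectors; by
      injectivity of \<open>b\<close>, \<open>c k\<close> is recovered at
      \<open>b k\<close>.\<close>
    let ?a = "\<lambda>x. c (inv_into {..<n} b x)"
    have a: "?a (b k) = c k" if "k < n" for k using that b(2) by simp
    have "F.lincomb ?a C = lin_comb F b n (\<lambda>k. ?a (b k))"
      unfolding b(1) by (rule lincomb_image_family) (use bc b F.module_axioms tuplesD(1)[OF c(1)] in auto)
    also have "\<dots> = \<zero>\<^bsub>F\<^esub>" using c(2) a by (simp cong: lin_comb_cong)
    finally have "F.lin_dep B"
      using C b \<open>i < n\<close> i a tuplesD(1)[OF c(1)] by (intro F.lin_dep_crit[of C B ?a "b i"]) auto
    then show False using B by simp
  qed
  moreover have "lin_comb F b n (\<lambda>i. \<zero>) = \<zero>\<^bsub>F\<^esub>"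
    by (rule lin_comb_zero[OF F.module_axioms bc]) simp
  then have "(\<lambda>i. \<zero>) \<in> relations R F b n" by (simp add: relations_def tuples_def)
  ultimately have "relations R F b n = {\<lambda>i. \<zero>}" by blast
  from that[OF bc this] show thesis using C(3) lin_comb_image[OF F.module_axioms bc] b(1) by auto
qed

lemma lin_comb_inj_on_tuples:
  assumes M: "module R M" and v: "v \<in> {..<n} \<rightarrow> carrier M" and rel: "relations R M v n = {\<lambda>i. \<zero>}"
  shows "inj_on (lin_comb M v n) (tuples R n)"
  by (rule inj_on_if_trivial_kernel[OF mod_hom_lin_comb[OF M v] submodule_tuples])
     (use rel in \<open>auto simp: relations_def\<close>)

section \<open>Finite generation by families\<close>

lemma finitely_generated_iff:
  assumes M: "module R M"
  shows "finitely_generated R M \<longleftrightarrow>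
    (\<exists>n. \<exists>v\<in>{..<n} \<rightarrow> carrier M. lin_comb M v n ` tuples R n = carrier M)"
proof
  assume "finitely_generated R M"
  then obtain A where A: "finite A" "A \<subseteq> carrier M" "module.span R M A = carrier M"
    unfolding finitely_generated_def by auto
  from finite_obtain_family[OF A(1)] obtain n and v :: "nat \<Rightarrow> _" where v: "A = v ` {..<n}" .
  then show "\<exists>n. \<exists>v\<in>{..<n} \<rightarrow> carrier M. lin_comb M v n ` tuples R n = carrier M"
    using A lin_comb_image[OF M, of v n] by (intro exI[of _ n] bexI[of _ v]) auto
next
  assume "\<exists>n. \<exists>v\<in>{..<n} \<rightarrow> carrier M. lin_comb M v n ` tuples R n = carrier M"
  then obtain n v where v: "v \<in> {..<n} \<rightarrow> carrier M" "lin_comb M v n ` tuples R n = carrier M" by auto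
  then show "finitely_generated R M"
    unfolding finitely_generated_def using lin_comb_image[OF M v(1)]
    by (intro exI[of _ "v ` {..<n}"]) auto
qed

lemma fg_submodule_iff_family:
  "fg_submodule R N M \<longleftrightarrow>
     submodule R N M \<and> (\<exists>n. \<exists>v\<in>{..<n} \<rightarrow> N. lin_comb M v n ` tuples R n = N)"
  unfolding fg_submodule_def using finitely_generated_iff[OF submodule_is_module, of N M] by auto

end

section \<open>The ring as a module over itself: ideals and residuals\<close>

lemma regular_module_simps [simp]:
  "carrier (regular_module R) = carrier R" "\<zero>\<^bsub>regular_module R\<^esub> = \<zero>\<^bsub>R\<^esub>"
  "x \<oplus>\<^bsub>regular_module R\<^esub> y = x \<oplus>\<^bsub>R\<^esub> y" "a \<odot>\<^bsub>regular_module R\<^esub> x = a \<otimes>\<^bsub>R\<^esub> x"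
  by (auto simp: regular_module_def)

lemma mod_hom_restrict:
  assumes h: "mod_hom R M N h" and U: "submodule R U M"
  shows "mod_hom R (M\<lparr>carrier := U\<rparr>) N h"
proof -
  interpret h: mod_hom R M N h by fact
  show ?thesis
    by (rule mod_homI[OF submodule_is_module[OF U] h.N.module_axioms])
       (use submoduleD(2)[OF U] in \<open>auto simp: subset_iff\<close>)
qed

lemma mod_hom_inclusion:
  assumes "submodule R U M" "submodule R V M" "U \<subseteq> V"
  shows "mod_hom R (M\<lparr>carrier := U\<rparr>) (M\<lparr>carrier := V\<rparr>) (\<lambda>x. x)"
  by (rule mod_homI[OF submodule_is_module submodule_is_module]) (use assms in auto)

context cring
begin

lemma tuples_1_image: "(\<lambda>c. c 0) ` tuples R 1 = carrier R"
proof
  show "(\<lambda>c. c 0) ` tuples R 1 \<subseteq> carrier R" by (auto simp: tuples_def)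
  show "carrier R \<subseteq> (\<lambda>c. c 0) ` tuples R 1"
    by (rule subsetI, rule_tac x = "\<lambda>i. if i = 0 then x else \<zero>" in rev_image_eqI)
       (auto simp: tuples_def)
qed

lemma regular_module_generator:
  "lin_comb (regular_module R) (\<lambda>_. \<one>) 1 ` tuples R 1 = carrier R"
proof -
  have "lin_comb (regular_module R) (\<lambda>_. \<one>) 1 c = c 0" if "c \<in> tuples R 1" for c
    using tuplesD(1)[OF that, of 0] by simp
  then have "lin_comb (regular_module R) (\<lambda>_. \<one>) 1 ` tuples R 1 = (\<lambda>c. c 0) ` tuples R 1"
    by (rule image_cong[OF refl])
  then show ?thesis using tuples_1_image by simp
qed

lemma submodule_regular_iff: "submodule R I (regular_module R) \<longleftrightarrow> ideal I R"
proof
  assume I: "submodule R I (regular_module R)"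
  note I' = submoduleD[OF I]
  show "ideal I R"
  proof (rule idealI[OF ring_axioms])
    have "\<ominus> a \<in> I" if "a \<in> I" for a
      using I'(5)[of "\<ominus> \<one>" a] I'(2) that by (auto simp: l_minus)
    then show "subgroup I (add_monoid R)"
      using I'(2,3,4) by unfold_locales (auto simp flip: a_inv_def)
    fix a x assume "a \<in> I" "x \<in> carrier R"
    then show "x \<otimes> a \<in> I" "a \<otimes> x \<in> I" using I'(2,5) by (auto simp: m_comm[of a x] subset_iff)
  qed
next
  assume "ideal I R"
  then interpret I: ideal I R .
  show "submodule R I (regular_module R)"
    unfolding submodule_def using module_regular_module I.a_subset I.I_l_closed by auto
qed

text \<open>Ideals are the submodules of the regular module, so the generated ideal and the span
  contain each other by minimality; a finite generating set is then listed as a family.\<close>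

lemma fg_ideal_iff:
  "fg_ideal I R \<longleftrightarrow>
     (\<exists>n. \<exists>u\<in>{..<n} \<rightarrow> carrier R. I = lin_comb (regular_module R) u n ` tuples R n)"
proof -
  let ?M = "regular_module R"
  interpret M: module R ?M by (rule module_regular_module)
  have gen: "genideal R A = M.span A" if "A \<subseteq> carrier R" for A
  proof
    have "ideal (M.span A) R" using M.span_is_submodule[of A] that by (simp add: submodule_regular_iff)
    then show "genideal R A \<subseteq> M.span A"
      using M.in_own_span[of A] that by (intro genideal_minimal) auto
    show "M.span A \<subseteq> genideal R A"
      using genideal_ideal[OF that] genideal_self[OF that]
      by (intro M.span_is_subset) (auto simp: submodule_regular_iff)
  qed
  show ?thesis
  proof
    assume "fg_ideal I R"
    then obtain A where A: "finite A" "A \<subseteq> carrier R" "I = M.span A"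
      unfolding fg_ideal_def using gen by auto
    from finite_obtain_family[OF A(1)] obtain n and u :: "nat \<Rightarrow> _" where u: "A = u ` {..<n}" .
    then show "\<exists>n. \<exists>u\<in>{..<n} \<rightarrow> carrier R. I = lin_comb ?M u n ` tuples R n"
      using A lin_comb_image[OF M.module_axioms, of u n] by (intro exI[of _ n] bexI[of _ u]) auto
  next
    assume "\<exists>n. \<exists>u\<in>{..<n} \<rightarrow> carrier R. I = lin_comb ?M u n ` tuples R n"
    then obtain n u where u: "u \<in> {..<n} \<rightarrow> carrier R" "I = lin_comb ?M u n ` tuples R n" by auto
    then show "fg_ideal I R"
      unfolding fg_ideal_def using lin_comb_image[OF M.module_axioms, of u n] gen[of "u ` {..<n}"]
      by (intro exI[of _ "u ` {..<n}"]) auto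
  qed
qed

text \<open>Generated by the empty family. It makes annihilators a special case of residuals of
  finitely generated ideals.\<close>

lemma fg_ideal_zero: "fg_ideal {\<zero>} R"
  unfolding fg_ideal_iff by (rule exI[of _ 0]) (auto simp: tuples_def image_def intro!: exI[of _ "\<lambda>i. \<zero>"])

lemma fg_ideal_submodule:
  assumes "u \<in> {..<n} \<rightarrow> carrier R"
  shows "submodule R (lin_comb (regular_module R) u n ` tuples R n) (regular_module R)"
  by (rule submodule_image[OF mod_hom_lin_comb submodule_tuples]) (use module_regular_module assms in auto)

lemma mod_hom_mult:
  assumes "a \<in> carrier R"
  shows "mod_hom R (regular_module R) (regular_module R) (\<lambda>x. x \<otimes> a)"
  by (rule mod_homI[OF module_regular_module module_regular_module])
     (use assms in \<open>auto simp: l_distr m_assoc\<close>)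

lemma submodule_residual:
  assumes "submodule R I (regular_module R)" "a \<in> carrier R"
  shows "submodule R (residual R I a) (regular_module R)"
  using submodule_vimage[OF mod_hom_mult[OF assms(2)] submodule_carrier[OF module_regular_module] assms(1)]
  by (simp add: residual_def)

text \<open>In a relation of \<open>u 0, ..., u n\<close> the last term is minus a combination of
  the first \<open>n\<close> elements, so its coefficient lies in the residual. Conversely, if
  \<open>x \<otimes> u n\<close> lies in their ideal, the coefficients of its negative, followed by
  \<open>x\<close>, form a relation.\<close>

lemma relations_last_coordinate:
  assumes u: "u \<in> {..<Suc n} \<rightarrow> carrier R"
  shows "(\<lambda>c. c n) ` relations R (regular_module R) u (Suc n) =
    residual R (lin_comb (regular_module R) u n ` tuples R n) (u n)"
proof -
  let ?M = "regular_module R"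
  let ?I = "lin_comb ?M u n ` tuples R n"
  have un: "u \<in> {..<n} \<rightarrow> carrier R" "u n \<in> carrier R" using u by auto
  have I: "submodule R ?I ?M" by (rule fg_ideal_submodule[OF un(1)])
  interpret M: module R ?M by (rule module_regular_module)
  \<comment> \<open>Negation is not a field of the record but derived from addition, so the two
    negations are identified by uniqueness of inverses.\<close>
  have neg: "\<ominus>\<^bsub>?M\<^esub> x = \<ominus> x" if "x \<in> carrier R" for x
    using that by (intro M.M.minus_equality) (auto simp: l_neg)
  have cl: "lin_comb ?M u n c \<in> carrier R" if "c \<in> tuples R n" for c
    using submoduleD(2)[OF I] that by auto
  have trunc: "(\<lambda>i. if i < n then c i else \<zero>) \<in> tuples R n \<and>
      lin_comb ?M u n (\<lambda>i. if i < n then c i else \<zero>) = lin_comb ?M u n c"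
    if "c \<in> tuples R m" for c m
    using tuplesD(1)[OF that] by (auto simp: tuples_def intro: lin_comb_cong)
  show ?thesis
  proof
    show "(\<lambda>c. c n) ` relations R ?M u (Suc n) \<subseteq> residual R ?I (u n)"
    proof
      fix x assume "x \<in> (\<lambda>c. c n) ` relations R ?M u (Suc n)"
      then obtain c where c: "c \<in> tuples R (Suc n)" "lin_comb ?M u n c \<oplus> c n \<otimes> u n = \<zero>" "x = c n"
        by (auto simp: relations_def)
      have y: "lin_comb ?M u n c \<in> ?I"
        by (rule image_eqI[where x = "\<lambda>i. if i < n then c i else \<zero>"]) (use trunc[OF c(1)] in auto)
      have cn: "c n \<in> carrier R" by (rule tuplesD(1)[OF c(1)])
      have yR: "lin_comb ?M u n c \<in> carrier R" using y submoduleD(2)[OF I] by auto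
      have "c n \<otimes> u n = \<ominus> lin_comb ?M u n c"
        using c(2) cn un(2) yR by (intro minus_equality[symmetric]) (auto simp: a_comm)
      then have "x \<otimes> u n \<in> ?I" using submodule_minus_closed(1)[OF I y y] neg yR c(3) by simp
      then show "x \<in> residual R ?I (u n)" using cn c(3) by (simp add: residual_def)
    qed
    show "residual R ?I (u n) \<subseteq> (\<lambda>c. c n) ` relations R ?M u (Suc n)"
    proof
      fix x assume "x \<in> residual R ?I (u n)"
      then have x: "x \<in> carrier R" "x \<otimes> u n \<in> ?I" by (auto simp: residual_def)
      then have "\<ominus> (x \<otimes> u n) \<in> ?I" using submodule_minus_closed(1)[OF I x(2) x(2)] neg un(2) by simp
      then obtain c where c: "c \<in> tuples R n" "\<ominus> (x \<otimes> u n) = lin_comb ?M u n c" by auto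
      let ?c = "c(n := x)"
      have "?c \<in> tuples R (Suc n)" using c(1) x(1) by (auto simp: tuples_def)
      moreover have "lin_comb ?M u n ?c = lin_comb ?M u n c" by (rule lin_comb_cong) auto
      then have "lin_comb ?M u (Suc n) ?c = \<zero>" using x(1) un(2) l_neg[of "x \<otimes> u n"] by (simp flip: c(2))
      ultimately have "?c \<in> relations R ?M u (Suc n)" by (simp add: relations_def)
      then show "x \<in> (\<lambda>c. c n) ` relations R ?M u (Suc n)" by (rule rev_image_eqI) simp
    qed
  qed
qed

text \<open>If \<open>A\<close> is the matrix expressing \<open>w\<close> by \<open>b\<close>, then
  the combination of \<open>w\<close> with coefficients \<open>c\<close> has coefficients
  \<open>A c\<close> over \<open>b\<close>. Relations in \<open>M\<close> thereby become a preimage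
  under a map between free modules.\<close>

lemma relations_lin_comb:
  assumes M: "module R M" and b: "b \<in> {..<n} \<rightarrow> carrier M" and A: "A \<in> {..<k} \<rightarrow> tuples R n"
    and w: "\<And>i. i < k \<Longrightarrow> w i = lin_comb M b n (A i)"
  shows "relations R M w k =
    {c \<in> tuples R k. lin_comb (seq_module R) A k c \<in> relations R M b n}"
proof -
  have "A \<in> {..<k} \<rightarrow> carrier (seq_module R)" using A tuplesD(3) by blast
  from lin_comb_hom[OF mod_hom_lin_comb[OF M b] this]
  have "lin_comb M w k c = lin_comb M b n (lin_comb (seq_module R) A k c)" if "c \<in> tuples R k" for c
    using tuplesD(1)[OF that] w by (simp cong: lin_comb_cong)
  moreover have "lin_comb (seq_module R) A k c \<in> tuples R n" if "c \<in> tuples R k" for c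
    using tuplesD(1)[OF that] by (intro lin_comb_closed[OF submodule_tuples A]) auto
  ultimately show ?thesis by (auto simp: relations_def)
qed

end

section \<open>S-coherence in terms of relations\<close>

context cring_with_mult_subset
begin

text \<open>Append to \<open>f\<close> a family \<open>g\<close> that generates \<open>U\<close> up
  to \<open>s\<close>. The first \<open>k\<close> coordinates of a relation of the joint family give
  a combination of \<open>f\<close> lying in \<open>U\<close>; conversely, the
  \<open>s\<close>-multiple of every \<open>c\<close> in the preimage extends to such a relation. So
  the truncated relations lie in the preimage and absorb it up to \<open>s\<close>.\<close>

lemma S_finite_sub_preimage:
  assumes M: "module R M" and f: "f \<in> {..<k} \<rightarrow> Y" and Y: "Y \<subseteq> carrier M" "S_finite_relations R S M Y"
    and U: "submodule R U M" "U \<subseteq> Y" "S_finite_sub R S M U"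
  shows "S_finite_sub R S (seq_module R) {c \<in> tuples R k. lin_comb M f k c \<in> U}"
proof -
  let ?P = "seq_module R"
  interpret M: module R M by fact
  from U(3) obtain A s where A: "finite A" "A \<subseteq> U" and s: "s \<in> S"
    and sU: "\<And>x. x \<in> U \<Longrightarrow> s \<odot>\<^bsub>M\<^esub> x \<in> M.span A"
    unfolding S_finite_sub_def by auto
  have sR: "s \<in> carrier R" using s S_closed by auto
  from finite_obtain_family[OF A(1)] obtain q and g :: "nat \<Rightarrow> _" where g: "A = g ` {..<q}" .
  have gU: "g \<in> {..<q} \<rightarrow> U" using A g by auto
  then have gc: "g \<in> {..<q} \<rightarrow> carrier M" and fc: "f \<in> {..<k} \<rightarrow> carrier M" using f U Y by auto
  define u where "u i = (if i < k then f i else g (i - k))" for i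
  have uY: "u \<in> {..<k + q} \<rightarrow> Y" using f gU U(2) by (auto simp: u_def Pi_iff)
  then have uc: "u \<in> {..<k + q} \<rightarrow> carrier M" using Y by auto
  let ?Z = "relations R M u (k + q)" and ?t = "\<lambda>c i. if i < k then c i else \<zero>"
  have split: "lin_comb M u (k + q) c = lin_comb M f k c \<oplus>\<^bsub>M\<^esub> lin_comb M g q (\<lambda>i. c (k + i))"
    if "\<And>i. c i \<in> carrier R" for c
    using lin_comb_add[OF M uc that] by (simp add: u_def cong: lin_comb_cong)
  have SZ: "S_finite_sub R S ?P ?Z" using Y(2) uY unfolding S_finite_relations_def by blast
  have Zc: "?Z \<subseteq> carrier ?P" using tuplesD(3) unfolding relations_def by blast
  have fcl: "lin_comb M f k c \<in> carrier M" if "\<And>i. c i \<in> carrier R" for c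
    using that by (intro lin_comb_closed[OF submodule_carrier[OF M] fc]) auto
  show ?thesis
  proof (rule S_finite_sub_between[OF module_seq_module _ S_finite_sub_image[OF mod_hom_truncate Zc SZ] _ s])
    show "{c \<in> tuples R k. lin_comb M f k c \<in> U} \<subseteq> carrier ?P" using tuplesD(3) by blast
    show "?t ` ?Z \<subseteq> {c \<in> tuples R k. lin_comb M f k c \<in> U}"
    proof
      fix x assume "x \<in> ?t ` ?Z"
      then obtain c where c: "c \<in> tuples R (k + q)" "lin_comb M u (k + q) c = \<zero>\<^bsub>M\<^esub>" "x = ?t c"
        by (auto simp: relations_def)
      note cR = tuplesD(1)[OF c(1)]
      have gU': "lin_comb M g q (\<lambda>i. c (k + i)) \<in> U" by (rule lin_comb_closed[OF U(1) gU cR])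
      have "lin_comb M f k c \<oplus>\<^bsub>M\<^esub> lin_comb M g q (\<lambda>i. c (k + i)) = \<zero>\<^bsub>M\<^esub>" using split[of c] cR c(2) by simp
      then have "lin_comb M f k c = \<ominus>\<^bsub>M\<^esub> lin_comb M g q (\<lambda>i. c (k + i))"
        using fcl[OF cR] gU' submoduleD(2)[OF U(1)] by (intro M.M.minus_equality[symmetric]) auto
      then have "lin_comb M f k c \<in> U" using submodule_minus_closed(1)[OF U(1) gU' gU'] by simp
      moreover have "lin_comb M f k x = lin_comb M f k c" unfolding c(3) by (rule lin_comb_cong) auto
      ultimately show "x \<in> {c \<in> tuples R k. lin_comb M f k c \<in> U}" using c(3) cR by (auto simp: tuples_def)
    qed
    fix c assume "c \<in> {c \<in> tuples R k. lin_comb M f k c \<in> U}"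
    then have c: "c \<in> tuples R k" "lin_comb M f k c \<in> U" by auto
    note cR = tuplesD(1)[OF c(1)]
    obtain b where b: "b \<in> tuples R q" "s \<odot>\<^bsub>M\<^esub> lin_comb M f k c = lin_comb M g q b"
      using sU[OF c(2)] lin_comb_image[OF M gc] g by auto
    note bR = tuplesD(1)[OF b(1)]
    interpret L: mod_hom R ?P M "lin_comb M f k" by (rule mod_hom_lin_comb[OF M fc])
    interpret G: mod_hom R ?P M "lin_comb M g q" by (rule mod_hom_lin_comb[OF M gc])
    \<comment> \<open>The extension of \<open>s c\<close> to a relation: \<open>b\<close> expresses
      \<open>s\<close> times the combination of \<open>f\<close> through \<open>g\<close>, and
      enters with a minus sign, shifted by \<open>k\<close>.\<close>
    let ?d = "\<lambda>i. if i < k then s \<otimes> c i else \<ominus> b (i - k)"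
    have d: "?d \<in> tuples R (k + q)" using cR bR sR tuplesD(2)[OF b(1)] by (auto simp: tuples_def)
    have "(\<lambda>i. \<ominus> b i) = (\<ominus> \<one>) \<odot>\<^bsub>?P\<^esub> b" using bR by (auto simp: fun_eq_iff l_minus)
    then have "lin_comb M g q (\<lambda>i. \<ominus> b i) = (\<ominus> \<one>) \<odot>\<^bsub>M\<^esub> lin_comb M g q b"
      using G.f_smult[of "\<ominus> \<one>" b] bR by simp
    also have "\<dots> = \<ominus>\<^bsub>M\<^esub> lin_comb M g q b"
      using G.f_im[OF tuplesD(3)[OF b(1)]] by (simp add: M.smult_minus_1)
    finally have 1: "lin_comb M g q (\<lambda>i. \<ominus> b i) = \<ominus>\<^bsub>M\<^esub> lin_comb M g q b" .
    have "lin_comb M f k ?d = lin_comb M f k (s \<odot>\<^bsub>?P\<^esub> c)" by (rule lin_comb_cong) auto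
    also have "\<dots> = s \<odot>\<^bsub>M\<^esub> lin_comb M f k c" by (rule L.f_smult[OF sR tuplesD(3)[OF c(1)]])
    finally have 2: "lin_comb M f k ?d = lin_comb M g q b" using b(2) by simp
    have "lin_comb M u (k + q) ?d = \<zero>\<^bsub>M\<^esub>"
      using split[OF tuplesD(1)[OF d]] 1 2 G.f_im[OF tuplesD(3)[OF b(1)]] by (simp add: M.M.r_neg)
    then have dZ: "?d \<in> ?Z" using d by (simp add: relations_def)
    have "s \<odot>\<^bsub>?P\<^esub> c = ?t ?d" using tuplesD(2)[OF c(1)] sR by (auto simp: fun_eq_iff)
    then show "s \<odot>\<^bsub>?P\<^esub> c \<in> ?t ` ?Z" using dZ by (rule image_eqI)
  qed
qed

text \<open>The \<open>n\<close> coordinate equations are imposed one at a time, starting from all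
  of \<open>R^k\<close>. Each step takes the kernel of a homomorphism from an S-finite module to
  \<open>R\<close>, which is S-finite by \<open>S_finite_sub_kernel\<close> and the hypothesis on
  \<open>R\<close>.\<close>

lemma S_finite_relations_tuples:
  assumes coh: "S_finite_relations R S (regular_module R) (carrier R)"
  shows "S_finite_relations R S (seq_module R) (tuples R n)"
  unfolding S_finite_relations_def
proof (intro allI ballI)
  fix k :: nat and v assume v: "v \<in> {..<k} \<rightarrow> tuples R n"
  let ?P = "seq_module R"
  have vc: "v \<in> {..<k} \<rightarrow> carrier ?P" using v tuplesD(3) by blast
  note L = mod_hom_lin_comb[OF module_seq_module vc]
  let ?U = "\<lambda>m. {c \<in> tuples R k. \<forall>i<m. lin_comb ?P v k c i = \<zero>}"
  have coord: "mod_hom R ?P (regular_module R) (\<lambda>c. lin_comb ?P v k c i)" for i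
    by (rule mod_hom_comp[OF L mod_hom_coordinate])
  have fin: "submodule R (?U m) ?P \<and> S_finite_sub R S ?P (?U m)" for m
  proof (induction m)
    case 0
    show ?case using submodule_tuples S_finite_sub_tuples by simp
  next
    case (Suc m)
    have eq: "?U (Suc m) = {c \<in> ?U m. lin_comb ?P v k c m = \<zero>\<^bsub>regular_module R\<^esub>}"
      by (auto simp: less_Suc_eq)
    have "submodule R {c \<in> ?U m. lin_comb ?P v k c m \<in> {\<zero>\<^bsub>regular_module R\<^esub>}} ?P"
      by (rule submodule_vimage[OF coord conjunct1[OF Suc.IH] submodule_zero[OF module_regular_module]])
    then have 1: "submodule R (?U (Suc m)) ?P" unfolding eq by simp
    have "(\<lambda>c. lin_comb ?P v k c m) ` ?U m \<subseteq> carrier R"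
    proof
      fix x assume "x \<in> (\<lambda>c. lin_comb ?P v k c m) ` ?U m"
      then obtain c where c: "c \<in> tuples R k" "x = lin_comb ?P v k c m" by auto
      then have "lin_comb ?P v k c \<in> tuples R n"
        using tuplesD(1)[OF c(1)] by (intro lin_comb_closed[OF submodule_tuples v]) auto
      then show "x \<in> carrier R" using tuplesD(1) c(2) by auto
    qed
    then have "S_finite_sub R S ?P (?U (Suc m))"
      unfolding eq by (rule S_finite_sub_kernel[OF coord conjunct1[OF Suc.IH] conjunct2[OF Suc.IH] _ coh])
    then show ?case using 1 by simp
  qed
  \<comment> \<open>Combinations of \<open>v\<close> stay in \<open>tuples R n\<close>, so they
    vanish as soon as their first \<open>n\<close> coordinates do.\<close>
  have eq: "?U n = relations R ?P v k"
  proof -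
    have "lin_comb ?P v k c \<in> tuples R n" if "c \<in> tuples R k" for c
      using tuplesD(1)[OF that] by (intro lin_comb_closed[OF submodule_tuples v]) auto
    from tuplesD(2)[OF this]
    have "(\<forall>i<n. lin_comb ?P v k c i = \<zero>) \<longleftrightarrow> lin_comb ?P v k c = (\<lambda>i. \<zero>)" if "c \<in> tuples R k" for c
      using that by (auto simp: fun_eq_iff not_less[symmetric])
    then show ?thesis by (auto simp: relations_def)
  qed
  show "S_finite_sub R S ?P (relations R ?P v k)"
    using conjunct2[OF fin[of n]] unfolding eq .
qed

text \<open>A family \<open>w\<close> in the span of \<open>b\<close> is given by a matrix
  \<open>A\<close>, and its relations are the preimage under \<open>A\<close> of the S-finite
  submodule of relations of \<open>b\<close> in \<open>R^n\<close>.\<close>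

lemma S_finite_relations_presented:
  assumes coh: "S_finite_relations R S (regular_module R) (carrier R)"
    and M: "module R M" and b: "b \<in> {..<n} \<rightarrow> carrier M" and fin: "S_finite_sub R S (seq_module R) (relations R M b n)"
  shows "S_finite_relations R S M (lin_comb M b n ` tuples R n)"
  unfolding S_finite_relations_def
proof (intro allI ballI)
  fix k :: nat and w assume w: "w \<in> {..<k} \<rightarrow> lin_comb M b n ` tuples R n"
  then have "\<forall>i\<in>{..<k}. \<exists>a. a \<in> tuples R n \<and> w i = lin_comb M b n a" by (auto simp: Pi_iff)
  then obtain A where A: "\<And>i. i < k \<Longrightarrow> A i \<in> tuples R n \<and> w i = lin_comb M b n (A i)"
    by (metis lessThan_iff)
  then have A': "A \<in> {..<k} \<rightarrow> tuples R n" by auto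
  have "tuples R n \<subseteq> carrier (seq_module R)" using tuplesD(3) by blast
  from S_finite_sub_preimage[OF module_seq_module A' this S_finite_relations_tuples[OF coh] submodule_relations[OF M b] _ fin]
  show "S_finite_sub R S (seq_module R) (relations R M w k)"
    using relations_lin_comb[OF M b A', of w] A by (auto simp: relations_def)
qed

lemma S_finite_sub_zero: "module R M \<Longrightarrow> S_finite_sub R S M {\<zero>\<^bsub>M\<^esub>}"
proof -
  assume "module R M"
  then interpret M: module R M .
  have "\<one> \<odot>\<^bsub>M\<^esub> \<zero>\<^bsub>M\<^esub> \<in> M.span {}" using submoduleD(3)[OF M.span_is_submodule[of "{}"]] by simp
  then show ?thesis unfolding S_finite_sub_def using S_closed(2) by (intro exI[of _ "{}"] exI[of _ \<one>]) auto
qed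

text \<open>A finite family in \<open>F\<close> lies in the span of finitely many basis elements,
  and these have only the zero relation, so the presented case applies in any rank.\<close>

lemma S_finite_relations_free_module:
  assumes coh: "S_finite_relations R S (regular_module R) (carrier R)" and F: "free_module R F"
  shows "S_finite_relations R S F (carrier F)"
  unfolding S_finite_relations_def
proof (intro allI ballI)
  fix k :: nat and w assume w: "w \<in> {..<k} \<rightarrow> carrier F"
  then have "finite (w ` {..<k})" "w ` {..<k} \<subseteq> carrier F" by auto
  from free_module_finite_basis[OF F this] obtain n b where b: "b \<in> {..<n} \<rightarrow> carrier F"
    "relations R F b n = {\<lambda>i. \<zero>}" "w ` {..<k} \<subseteq> lin_comb F b n ` tuples R n" .
  have M: "module R F" using F by (simp add: free_module_def)
  have "S_finite_sub R S (seq_module R) (relations R F b n)"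
    using S_finite_sub_zero[OF module_seq_module] b(2) by simp
  from S_finite_relations_presented[OF coh M b(1) this] show "S_finite_sub R S (seq_module R) (relations R F w k)"
    unfolding S_finite_relations_def using b(3) by (auto simp: Pi_iff image_subset_iff)
qed

text \<open>A finitely generated free module is some \<open>R^n\<close>; under this identification
  the kernel of a presentation is the relation module of the images of the basis. Conversely, the
  relation module included in \<open>R^n\<close>, followed by the combination map, is a
  presentation.\<close>

lemma S_finitely_presented_iff:
  assumes M: "module R M"
  shows "S_finitely_presented R S M \<longleftrightarrow>
    (\<exists>n. \<exists>v\<in>{..<n} \<rightarrow> carrier M. lin_comb M v n ` tuples R n = carrier M \<and>
       S_finite_sub R S (seq_module R) (relations R M v n))"
proof
  let ?P = "seq_module R"
  assume "S_finitely_presented R S M"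
  then obtain K F :: "('a, nat \<Rightarrow> 'a) module" and i p
    where ex: "short_exact R K i F p M" and K: "S_finite R S K"
      and F: "free_module R F" "finitely_generated R F"
    unfolding S_finitely_presented_def by blast
  interpret i: mod_hom R K F i using ex by (simp add: short_exact_def)
  interpret p: mod_hom R F M p using ex by (simp add: short_exact_def)
  have ker: "i ` carrier K = {x \<in> carrier F. p x = \<zero>\<^bsub>M\<^esub>}" and im: "p ` carrier F = carrier M"
    using ex i.im_def p.ker_def p.im_def by (auto simp: short_exact_def)
  from F(2) obtain A where A: "finite A" "A \<subseteq> carrier F" "i.N.span A = carrier F"
    unfolding finitely_generated_def by auto
  \<comment> \<open>The finite part \<open>b\<close> of the basis whose span contains the generators
    \<open>A\<close> of \<open>F\<close> spans all of \<open>F\<close>.\<close>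
  from free_module_finite_basis[OF F(1) A(1,2)] obtain n b where b: "b \<in> {..<n} \<rightarrow> carrier F"
    "relations R F b n = {\<lambda>i. \<zero>}" "A \<subseteq> lin_comb F b n ` tuples R n" .
  let ?L = "lin_comb F b n"
  have L: "mod_hom R ?P F ?L" by (rule mod_hom_lin_comb[OF i.N.module_axioms b(1)])
  have "submodule R (?L ` tuples R n) F" by (rule submodule_image[OF L submodule_tuples])
  from i.N.span_is_subset[OF b(3) this] submoduleD(2)[OF this] A(3)
  have surj: "?L ` tuples R n = carrier F" by auto
  have inj: "inj_on ?L (tuples R n)" by (rule lin_comb_inj_on_tuples[OF i.N.module_axioms b(1,2)])
  have bij: "bij_betw ?L (tuples R n) (carrier F)" using surj inj by (simp add: bij_betw_def)
  let ?v = "\<lambda>i. p (b i)"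
  have v: "?v \<in> {..<n} \<rightarrow> carrier M" using b(1) by auto
  have Lv: "lin_comb M ?v n c = p (?L c)" if "c \<in> tuples R n" for c
    by (rule lin_comb_hom[OF p.mod_hom_axioms b(1), symmetric]) (use tuplesD(1)[OF that] in auto)
  have "lin_comb M ?v n ` tuples R n = p ` ?L ` tuples R n"
    using Lv by (simp add: image_image)
  then have gen: "lin_comb M ?v n ` tuples R n = carrier M" using surj im by simp
  \<comment> \<open>\<open>S_finite_iff\<close> is about restricted carriers; \<open>K\<close> is
    regarded as the restriction to its own carrier.\<close>
  have "K\<lparr>carrier := carrier K\<rparr> = K" by simp
  then have "S_finite_sub R S K (carrier K)"
    using K S_finite_iff[OF submodule_carrier[OF i.M.module_axioms], of S] by simp
  from S_finite_sub_image[OF i.mod_hom_axioms order_refl this]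
  have "S_finite_sub R S ?P (inv_into (tuples R n) ?L ` i ` carrier K)"
    by (intro S_finite_sub_image[OF mod_hom_inv_into[OF L submodule_tuples bij]]) auto
  moreover have "inv_into (tuples R n) ?L ` i ` carrier K = relations R M ?v n"
  proof
    show "inv_into (tuples R n) ?L ` i ` carrier K \<subseteq> relations R M ?v n"
      unfolding ker using Lv surj by (auto simp: relations_def inv_into_into f_inv_into_f)
    show "relations R M ?v n \<subseteq> inv_into (tuples R n) ?L ` i ` carrier K"
    proof
      fix c assume "c \<in> relations R M ?v n"
      then have c: "c \<in> tuples R n" "p (?L c) = \<zero>\<^bsub>M\<^esub>" using Lv by (auto simp: relations_def)
      have 1: "?L c \<in> i ` carrier K" unfolding ker using c surj by auto
      have 2: "c = inv_into (tuples R n) ?L (?L c)" using inj c(1) by simp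
      show "c \<in> inv_into (tuples R n) ?L ` i ` carrier K" by (rule image_eqI[where f = "inv_into (tuples R n) ?L" and x = "?L c", OF 2 1])
    qed
  qed
  ultimately show "\<exists>n. \<exists>v\<in>{..<n} \<rightarrow> carrier M. lin_comb M v n ` tuples R n = carrier M \<and>
       S_finite_sub R S ?P (relations R M v n)"
    using v gen by metis
next
  let ?P = "seq_module R"
  assume "\<exists>n. \<exists>v\<in>{..<n} \<rightarrow> carrier M. lin_comb M v n ` tuples R n = carrier M \<and>
       S_finite_sub R S ?P (relations R M v n)"
  then obtain n v where v: "v \<in> {..<n} \<rightarrow> carrier M" "lin_comb M v n ` tuples R n = carrier M"
    and fin: "S_finite_sub R S ?P (relations R M v n)" by auto
  let ?F = "?P\<lparr>carrier := tuples R n\<rparr>" and ?K = "?P\<lparr>carrier := relations R M v n\<rparr>"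
  note rel = submodule_relations[OF M v(1)]
  note L = mod_hom_lin_comb[OF M v(1)]
  have sub: "relations R M v n \<subseteq> tuples R n" by (auto simp: relations_def)
  have F: "module R ?F" by (rule submodule_is_module[OF submodule_tuples])
  have i: "mod_hom R ?K ?F (\<lambda>x. x)" by (rule mod_hom_inclusion[OF rel submodule_tuples sub])
  have p: "mod_hom R ?F M (lin_comb M v n)" by (rule mod_hom_restrict[OF L submodule_tuples])
  have ex: "short_exact R ?K (\<lambda>x. x) ?F (lin_comb M v n) M"
    unfolding short_exact_def mod_hom.im_def[OF i] mod_hom.ker_def[OF p] mod_hom.im_def[OF p]
    by (intro conjI i p) (auto simp: relations_def v(2))
  have K: "S_finite R S ?K" using S_finite_iff[OF rel] fin by simp
  have u: "unit_tuple R \<in> {..<n} \<rightarrow> carrier ?F" using unit_tuple_in_tuples by auto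
  have uc: "lin_comb ?F (unit_tuple R) n ` tuples R n = carrier ?F"
    using lin_comb_unit_tuples by force
  have "relations R ?F (unit_tuple R) n \<subseteq> {\<lambda>i. \<zero>}"
    using lin_comb_unit_tuples by (auto simp: relations_def)
  then have "free_module R ?F" by (rule free_moduleI[OF F u uc])
  moreover have "finitely_generated R ?F" using finitely_generated_iff[OF F] u uc by blast
  ultimately show "S_finitely_presented R S M"
    unfolding S_finitely_presented_def using ex K by blast
qed

text \<open>A presentation supplies some generating family with S-finite relations; the change of
  generators passes to the given family \<open>w\<close>.\<close>

lemma S_finitely_presented_submodule_iff:
  assumes N: "submodule R N M" and w: "w \<in> {..<k} \<rightarrow> N" "lin_comb M w k ` tuples R k = N"
  shows "S_finitely_presented R S (M\<lparr>carrier := N\<rparr>) \<longleftrightarrow> S_finite_sub R S (seq_module R) (relations R M w k)"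
proof
  note M = submodule_is_module[OF N]
  assume "S_finitely_presented R S (M\<lparr>carrier := N\<rparr>)"
  then obtain n v where v: "v \<in> {..<n} \<rightarrow> N" "lin_comb M v n ` tuples R n = N"
    and fin: "S_finite_sub R S (seq_module R) (relations R M v n)"
    unfolding S_finitely_presented_iff[OF M] by auto
  from S_finite_sub_relations_change_generators[OF M, of v n w k]
  show "S_finite_sub R S (seq_module R) (relations R M w k)" using v w fin by auto
next
  assume "S_finite_sub R S (seq_module R) (relations R M w k)"
  then show "S_finitely_presented R S (M\<lparr>carrier := N\<rparr>)"
    unfolding S_finitely_presented_iff[OF submodule_is_module[OF N]] using w by auto
qed

text \<open>Every finite family generates a finitely generated submodule, and every such submodule
  arises so; the generating family can be the given one because presentability does not depend on
  it.\<close>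

lemma S_finite_relations_iff_fg_submodules:
  assumes M: "module R M"
  shows "S_finite_relations R S M (carrier M) \<longleftrightarrow>
    (\<forall>N. fg_submodule R N M \<longrightarrow> S_finitely_presented R S (M\<lparr>carrier := N\<rparr>))"
proof safe
  fix N assume fin: "S_finite_relations R S M (carrier M)" and N: "fg_submodule R N M"
  then obtain n v where v: "submodule R N M" "v \<in> {..<n} \<rightarrow> N" "lin_comb M v n ` tuples R n = N"
    unfolding fg_submodule_iff_family by auto
  have "v \<in> {..<n} \<rightarrow> carrier M" using v(2) submoduleD(2)[OF v(1)] by auto
  then have "S_finite_sub R S (seq_module R) (relations R M v n)" using fin unfolding S_finite_relations_def by blast
  then show "S_finitely_presented R S (M\<lparr>carrier := N\<rparr>)"
    using S_finitely_presented_submodule_iff[OF v] by simp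
next
  assume fp: "\<forall>N. fg_submodule R N M \<longrightarrow> S_finitely_presented R S (M\<lparr>carrier := N\<rparr>)"
  show "S_finite_relations R S M (carrier M)"
    unfolding S_finite_relations_def
  proof (intro allI ballI)
    fix n :: nat and v assume v: "v \<in> {..<n} \<rightarrow> carrier M"
    let ?N = "lin_comb M v n ` tuples R n"
    have N: "submodule R ?N M" by (rule submodule_image[OF mod_hom_lin_comb[OF M v] submodule_tuples])
    have "v i \<in> ?N" if "i < n" for i
      using lin_comb_unit_tuple[OF M v that] unit_tuple_in_tuples[OF that] by (metis imageI)
    then have vN: "v \<in> {..<n} \<rightarrow> ?N" by auto
    then have "fg_submodule R ?N M" unfolding fg_submodule_iff_family using N by blast
    with fp have "S_finitely_presented R S (M\<lparr>carrier := ?N\<rparr>)" by blast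
    then show "S_finite_sub R S (seq_module R) (relations R M v n)"
      using S_finitely_presented_submodule_iff[OF N vN refl] by simp
  qed
qed

section \<open>Coherence of the ring, residuals and intersections\<close>

lemma S_coherent_iff:
  assumes "module R M"
  shows "S_coherent R S M \<longleftrightarrow> finitely_generated R M \<and> S_finite_relations R S M (carrier M)"
  unfolding S_coherent_def S_finite_relations_iff_fg_submodules[OF assms] ..

lemma S_coherent_ring_iff:
  "S_coherent_ring R S \<longleftrightarrow> S_finite_relations R S (regular_module R) (carrier R)"
proof -
  have "finitely_generated R (regular_module R)"
    unfolding finitely_generated_iff[OF module_regular_module]
    using regular_module_generator by (intro exI[of _ 1] bexI[of _ "\<lambda>_. \<one>"]) auto
  then show ?thesis
    unfolding S_coherent_ring_def S_coherent_iff[OF module_regular_module] by simp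
qed

lemma S_finite_ideal_iff:
  "S_finite_ideal R S I \<longleftrightarrow> ideal I R \<and> S_finite_sub R S (regular_module R) I"
  unfolding S_finite_ideal_def using S_finite_iff[of R I "regular_module R" S]
  by (auto simp: submodule_regular_iff)

text \<open>With \<open>a\<close> appended to the generators of \<open>I\<close>, the residual is
  the image of an S-finite relation module under the last coordinate.\<close>

lemma residual_S_finite_if_coherent:
  assumes coh: "S_finite_relations R S (regular_module R) (carrier R)"
    and I: "fg_ideal I R" and a: "a \<in> carrier R"
  shows "S_finite_ideal R S (residual R I a)"
proof -
  let ?M = "regular_module R"
  from I obtain n u where u: "u \<in> {..<n} \<rightarrow> carrier R" "I = lin_comb ?M u n ` tuples R n"
    unfolding fg_ideal_iff by auto
  let ?u = "u(n := a)"
  have u': "?u \<in> {..<Suc n} \<rightarrow> carrier R" using u(1) a by (auto simp: Pi_iff less_Suc_eq)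
  have "lin_comb ?M ?u n c = lin_comb ?M u n c" for c by (rule lin_comb_cong) auto
  then have im: "(\<lambda>c. c n) ` relations R ?M ?u (Suc n) = residual R I a"
    using relations_last_coordinate[OF u'] u(2) by (simp add: image_def del: lin_comb.simps)
  have "relations R ?M ?u (Suc n) \<subseteq> carrier (seq_module R)"
    using tuplesD(3) unfolding relations_def by blast
  from S_finite_sub_image[OF mod_hom_coordinate this, of n] have "S_finite_sub R S ?M (residual R I a)"
    unfolding im using coh u' unfolding S_finite_relations_def by blast
  moreover have "ideal (residual R I a) R"
    using submodule_residual[OF fg_ideal_submodule[OF u(1)] a] u(2) by (simp add: submodule_regular_iff)
  ultimately show ?thesis by (simp add: S_finite_ideal_iff)
qed

lemma coherent_if_residual_S_finite:
  assumes res: "\<And>I a. a \<in> carrier R \<Longrightarrow> fg_ideal I R \<Longrightarrow> S_finite_ideal R S (residual R I a)"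
  shows "S_finite_relations R S (regular_module R) (carrier R)"
  unfolding S_finite_relations_def
proof (intro allI ballI)
  let ?M = "regular_module R" and ?P = "seq_module R"
  fix n :: nat and u assume "u \<in> {..<n} \<rightarrow> carrier R"
  then show "S_finite_sub R S ?P (relations R ?M u n)"
  proof (induction n)
    case 0
    have "tuples R 0 = {\<zero>\<^bsub>?P\<^esub>}" by (auto simp: tuples_def)
    then have "relations R ?M u 0 = {\<zero>\<^bsub>?P\<^esub>}" by (auto simp: relations_def)
    then show ?case using S_finite_sub_zero[OF module_seq_module] by simp
  next
    case (Suc n)
    have u: "u \<in> {..<n} \<rightarrow> carrier R" "u n \<in> carrier R" using Suc.prems by auto
    have "fg_ideal (lin_comb ?M u n ` tuples R n) R" unfolding fg_ideal_iff using u(1) by blast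
    then have im: "S_finite_sub R S ?M ((\<lambda>c. c n) ` relations R ?M u (Suc n))"
      using res[OF u(2)] relations_last_coordinate[OF Suc.prems] by (simp add: S_finite_ideal_iff)
    \<comment> \<open>Relations of the shorter family are the kernel of the last coordinate, as an
      equality of sets, because tuples are padded with zeros.\<close>
    have "c \<in> relations R ?M u n \<longleftrightarrow> c \<in> relations R ?M u (Suc n) \<and> c n = \<zero>" for c
    proof -
      have "c \<in> tuples R n \<longleftrightarrow> c \<in> tuples R (Suc n) \<and> c n = \<zero>"
        by (auto simp: tuples_def le_Suc_eq) (metis Suc_leI le_neq_implies_less)
      moreover have "lin_comb ?M u (Suc n) c = lin_comb ?M u n c" if "c n = \<zero>" "c \<in> tuples R (Suc n)"
        using that u tuplesD(1)[OF that(2)]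
          lin_comb_closed[OF submodule_carrier[OF module_regular_module], of u n c] by simp
      ultimately show ?thesis by (auto simp: relations_def simp del: lin_comb.simps)
    qed
    then have "{c \<in> relations R ?M u (Suc n). c n = \<zero>\<^bsub>?M\<^esub>} = relations R ?M u n" by auto
    then have ker: "S_finite_sub R S ?P {c \<in> relations R ?M u (Suc n). c n = \<zero>\<^bsub>?M\<^esub>}"
      using Suc.IH[OF u(1)] by simp
    have "submodule R (relations R ?M u (Suc n)) ?P"
      using submodule_relations[OF module_regular_module] Suc.prems by simp
    from S_finite_sub_extension[OF mod_hom_coordinate this im ker] show ?case .
  qed
qed

text \<open>The intersection is the image, under the map from \<open>R^n\<close> onto
  \<open>I\<close>, of the preimage of \<open>J\<close>, and that preimage is S-finite by
  \<open>S_finite_sub_preimage\<close>.\<close>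

lemma intersection_S_finite_if_coherent:
  assumes coh: "S_finite_relations R S (regular_module R) (carrier R)"
    and I: "fg_ideal I R" and J: "fg_ideal J R"
  shows "S_finite_ideal R S (I \<inter> J)"
proof -
  let ?M = "regular_module R"
  from I obtain n u where u: "u \<in> {..<n} \<rightarrow> carrier R" "I = lin_comb ?M u n ` tuples R n"
    unfolding fg_ideal_iff by auto
  from J obtain m w where w: "w \<in> {..<m} \<rightarrow> carrier R" "J = lin_comb ?M w m ` tuples R m"
    unfolding fg_ideal_iff by auto
  have Is: "submodule R I ?M" and Js: "submodule R J ?M" using fg_ideal_submodule u w by auto
  have uc: "u \<in> {..<n} \<rightarrow> carrier ?M" and wc: "w \<in> {..<m} \<rightarrow> carrier ?M" using u w by auto
  note L = mod_hom_lin_comb[OF module_regular_module uc]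
  have "S_finite_sub R S ?M J"
    unfolding w(2) using S_finite_sub_image[OF mod_hom_lin_comb[OF module_regular_module wc] _ S_finite_sub_tuples]
      submoduleD(2)[OF submodule_tuples] by blast
  from S_finite_sub_preimage[OF module_regular_module uc order_refl _ Js _ this] coh submoduleD(2)[OF Js]
  have "S_finite_sub R S (seq_module R) {c \<in> tuples R n. lin_comb ?M u n c \<in> J}" by simp
  from S_finite_sub_image[OF L _ this] tuplesD(3)
  have "S_finite_sub R S ?M (lin_comb ?M u n ` {c \<in> tuples R n. lin_comb ?M u n c \<in> J})" by blast
  moreover have "lin_comb ?M u n ` {c \<in> tuples R n. lin_comb ?M u n c \<in> J} = I \<inter> J" using u(2) by auto
  moreover have "ideal (I \<inter> J) R"
    using Is Js by (intro i_intersect) (auto simp: submodule_regular_iff)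
  ultimately show ?thesis by (simp add: S_finite_ideal_iff)
qed

text \<open>Multiplication by \<open>a\<close> maps \<open>(I : a)\<close> onto \<open>I \<inter> aR\<close> with kernel \<open>(0 : a)\<close>.\<close>

lemma residual_S_finite_if_intersection:
  assumes ann: "S_finite_ideal R S (residual R {\<zero>} a)"
    and int: "\<And>I J. fg_ideal I R \<Longrightarrow> fg_ideal J R \<Longrightarrow> S_finite_ideal R S (I \<inter> J)"
    and I: "fg_ideal I R" and a: "a \<in> carrier R"
  shows "S_finite_ideal R S (residual R I a)"
proof -
  let ?M = "regular_module R"
  from I obtain n u where u: "u \<in> {..<n} \<rightarrow> carrier R" "I = lin_comb ?M u n ` tuples R n"
    unfolding fg_ideal_iff by auto
  have Is: "submodule R I ?M" using fg_ideal_submodule u by auto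
  have "fg_ideal (PIdl a) R"
    unfolding fg_ideal_def using cgenideal_eq_genideal[OF a] a by (intro exI[of _ "{a}"]) auto
  from int[OF I this] have "S_finite_sub R S ?M (I \<inter> PIdl a)" by (simp add: S_finite_ideal_iff)
  moreover have "I \<inter> PIdl a = (\<lambda>x. x \<otimes> a) ` residual R I a"
    by (auto simp: cgenideal_def residual_def)
  ultimately have im: "S_finite_sub R S ?M ((\<lambda>x. x \<otimes> a) ` residual R I a)" by simp
  have "{x \<in> residual R I a. x \<otimes> a = \<zero>\<^bsub>?M\<^esub>} = residual R {\<zero>} a"
    using submoduleD(3)[OF Is] by (auto simp: residual_def)
  then have ker: "S_finite_sub R S ?M {x \<in> residual R I a. x \<otimes> a = \<zero>\<^bsub>?M\<^esub>}"
    using ann by (simp add: S_finite_ideal_iff)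
  from S_finite_sub_extension[OF mod_hom_mult[OF a] submodule_residual[OF Is a] im ker]
  show ?thesis using submodule_residual[OF Is a] by (simp add: S_finite_ideal_iff submodule_regular_iff)
qed

lemma S_finitely_presented_imp_S_coherent:
  assumes coh: "S_finite_relations R S (regular_module R) (carrier R)"
    and M: "module R M" and fp: "S_finitely_presented R S M"
  shows "S_coherent R S M"
proof -
  from fp obtain n v where v: "v \<in> {..<n} \<rightarrow> carrier M" "lin_comb M v n ` tuples R n = carrier M"
    "S_finite_sub R S (seq_module R) (relations R M v n)"
    unfolding S_finitely_presented_iff[OF M] by auto
  have "finitely_generated R M" unfolding finitely_generated_iff[OF M] using v by blast
  then show ?thesis
    using S_finite_relations_presented[OF coh M v(1,3)] v(2) by (simp add: S_coherent_iff[OF M])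
qed

text \<open>An injective homomorphism preserves and reflects zero, so a family and its image have
  the same relations. This leads back from the copy of the ring in \<open>'m\<close> to the
  ring.\<close>

lemma S_finite_relations_inj_hom:
  assumes h: "mod_hom R M N h" and inj: "inj_on h (carrier M)" and N: "S_finite_relations R S N (carrier N)"
  shows "S_finite_relations R S M (carrier M)"
  unfolding S_finite_relations_def
proof (intro allI ballI)
  interpret h: mod_hom R M N h by fact
  fix n :: nat and v assume v: "v \<in> {..<n} \<rightarrow> carrier M"
  have "lin_comb N (\<lambda>i. h (v i)) n c = \<zero>\<^bsub>N\<^esub> \<longleftrightarrow> lin_comb M v n c = \<zero>\<^bsub>M\<^esub>" if "c \<in> tuples R n" for c
  proof -
    have "lin_comb M v n c \<in> carrier M"
      using tuplesD(1)[OF that] by (intro lin_comb_closed[OF submodule_carrier[OF h.M.module_axioms] v])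
    moreover have "h (lin_comb M v n c) = lin_comb N (\<lambda>i. h (v i)) n c"
      by (rule lin_comb_hom[OF h v]) (use tuplesD(1)[OF that] in auto)
    ultimately show ?thesis
      using inj_onD[OF inj, of "lin_comb M v n c" "\<zero>\<^bsub>M\<^esub>"] by auto
  qed
  then have "relations R N (\<lambda>i. h (v i)) n = relations R M v n" by (auto simp: relations_def)
  moreover have "(\<lambda>i. h (v i)) \<in> {..<n} \<rightarrow> carrier N" using v by auto
  ultimately show "S_finite_sub R S (seq_module R) (relations R M v n)" using N unfolding S_finite_relations_def by metis
qed

end

section \<open>Transport of the ring to the universe\<close>

text \<open>A copy of the regular module with carrier in \<open>'m\<close>. The conditions on all
  modules over \<open>'m\<close> cannot be applied to \<open>regular_module R\<close>, whose
  elements have type \<open>'a\<close>, but they can be applied to this copy.\<close>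

definition transported_module :: "('a, 'r) ring_scheme \<Rightarrow> ('a \<Rightarrow> 'm) \<Rightarrow> ('a, 'm) module" where
  "transported_module R e =
     (let g = inv_into (carrier R) e in
      \<lparr>carrier = e ` carrier R, monoid.mult = (\<lambda>x y. e (g x \<otimes>\<^bsub>R\<^esub> g y)), one = e \<one>\<^bsub>R\<^esub>,
       ring.zero = e \<zero>\<^bsub>R\<^esub>, add = (\<lambda>x y. e (g x \<oplus>\<^bsub>R\<^esub> g y)),
       module.smult = (\<lambda>a x. e (a \<otimes>\<^bsub>R\<^esub> g x))\<rparr>)"

context cring
begin

lemma transported_module_simps:
  assumes "inj_on e (carrier R)"
  shows "carrier (transported_module R e) = e ` carrier R" "\<zero>\<^bsub>transported_module R e\<^esub> = e \<zero>"
    "\<And>x y. x \<in> carrier R \<Longrightarrow> y \<in> carrier R \<Longrightarrow> e x \<oplus>\<^bsub>transported_module R e\<^esub> e y = e (x \<oplus> y)"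
    "\<And>a x. x \<in> carrier R \<Longrightarrow> a \<odot>\<^bsub>transported_module R e\<^esub> e x = e (a \<otimes> x)"
  using assms by (auto simp: transported_module_def Let_def)

lemma module_transported_module:
  assumes e: "inj_on e (carrier R)"
  shows "module R (transported_module R e)"
proof (rule module_criteria)
  note [simp] = transported_module_simps[OF e]
  show "\<forall>v\<in>carrier (transported_module R e). \<exists>w\<in>carrier (transported_module R e).
      v \<oplus>\<^bsub>transported_module R e\<^esub> w = \<zero>\<^bsub>transported_module R e\<^esub>"
  proof
    fix v assume "v \<in> carrier (transported_module R e)"
    then obtain x where "x \<in> carrier R" "v = e x" by auto
    then show "\<exists>w\<in>carrier (transported_module R e).
        v \<oplus>\<^bsub>transported_module R e\<^esub> w = \<zero>\<^bsub>transported_module R e\<^esub>"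
      by (intro bexI[of _ "e (\<ominus> x)"]) (auto simp: r_neg)
  qed
qed (auto simp: transported_module_simps[OF e] is_cring m_assoc l_distr r_distr a_ac)

lemma mod_hom_transported_module:
  assumes e: "inj_on e (carrier R)"
  shows "mod_hom R (regular_module R) (transported_module R e) e"
  by (rule mod_homI[OF module_regular_module module_transported_module[OF e]])
     (auto simp: transported_module_simps[OF e])

text \<open>The copy is free on the single generator \<open>e \<one>\<close>, which makes it a test
  module for both conditions on modules.\<close>

lemma transported_module_generator:
  assumes e: "inj_on e (carrier R)"
  shows "lin_comb (transported_module R e) (\<lambda>_. e \<one>) 1 ` tuples R 1 = carrier (transported_module R e)"
    and "relations R (transported_module R e) (\<lambda>_. e \<one>) 1 = {\<lambda>i. \<zero>}"
proof -
  have eq: "lin_comb (transported_module R e) (\<lambda>_. e \<one>) 1 c = e (c 0)" if "c \<in> tuples R 1" for c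
    using tuplesD(1)[OF that, of 0] transported_module_simps[OF e] by simp
  have "lin_comb (transported_module R e) (\<lambda>_. e \<one>) 1 ` tuples R 1 = (\<lambda>c. e (c 0)) ` tuples R 1"
    by (rule image_cong[OF refl eq])
  also have "\<dots> = e ` (\<lambda>c. c 0) ` tuples R 1" by (simp only: image_image)
  finally show "lin_comb (transported_module R e) (\<lambda>_. e \<one>) 1 ` tuples R 1 = carrier (transported_module R e)"
    using tuples_1_image by (simp add: transported_module_simps[OF e])
  have "c = (\<lambda>i. \<zero>)" if "c \<in> tuples R 1" "e (c 0) = e \<zero>" for c
  proof
    fix i
    have "c 0 = \<zero>" using inj_onD[OF e that(2)] tuplesD(1)[OF that(1)] by simp
    then show "c i = \<zero>" using tuplesD(2)[OF that(1), of i] by (cases "i = 0") auto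
  qed
  note zero = this
  have 0: "(\<lambda>i. \<zero>) \<in> tuples R 1" by (simp add: tuples_def)
  show "relations R (transported_module R e) (\<lambda>_. e \<one>) 1 = {\<lambda>i. \<zero>}"
  proof
    show "relations R (transported_module R e) (\<lambda>_. e \<one>) 1 \<subseteq> {\<lambda>i. \<zero>}"
    proof
      fix c assume "c \<in> relations R (transported_module R e) (\<lambda>_. e \<one>) 1"
      then have c: "c \<in> tuples R 1"
        "lin_comb (transported_module R e) (\<lambda>_. e \<one>) 1 c = \<zero>\<^bsub>transported_module R e\<^esub>"
        unfolding relations_def by blast+
      then have "e (c 0) = e \<zero>" unfolding eq[OF c(1)] transported_module_simps(2)[OF e] by blast
      from zero[OF c(1) this] show "c \<in> {\<lambda>i. \<zero>}" by blast
    qed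
    show "{\<lambda>i. \<zero>} \<subseteq> relations R (transported_module R e) (\<lambda>_. e \<one>) 1"
      unfolding relations_def transported_module_simps(2)[OF e] using 0 eq[OF 0] by blast
  qed
qed

end

theorem theorem3p8:
  fixes R :: "('a, 'r) ring_scheme"
    and S :: "'a set"
    and emb :: "'a \<Rightarrow> 'm"
  assumes "cring R"
    and "submonoid S R"
    and "inj_on emb (carrier R)"
  shows
    "(S_coherent_ring R S \<longleftrightarrow>
       (\<forall>M :: ('a, 'm) module. module R M \<and> S_finitely_presented R S M \<longrightarrow> S_coherent R S M))
     \<and>
     (S_coherent_ring R S \<longleftrightarrow>
       (\<forall>(F :: ('a, 'm) module) N. free_module R F \<and> fg_submodule R N F \<longrightarrow>
          S_finitely_presented R S (F\<lparr>carrier := N\<rparr>)))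
     \<and>
     (S_coherent_ring R S \<longleftrightarrow>
       (\<forall>I. \<forall>a\<in>carrier R. fg_ideal I R \<longrightarrow> S_finite_ideal R S (residual R I a)))
     \<and>
     (S_coherent_ring R S \<longleftrightarrow>
       (\<forall>a\<in>carrier R. S_finite_ideal R S (residual R {\<zero>\<^bsub>R\<^esub>} a)) \<and>
       (\<forall>I J. fg_ideal I R \<and> fg_ideal J R \<longrightarrow> S_finite_ideal R S (I \<inter> J)))"
    (is "(?coh \<longleftrightarrow> ?fp) \<and> (?coh \<longleftrightarrow> ?free) \<and> (?coh \<longleftrightarrow> ?res) \<and> (?coh \<longleftrightarrow> ?ann \<and> ?int)")
proof -
  interpret cring_with_mult_subset R S
    using assms by (simp add: cring_with_mult_subset_def cring_with_mult_subset_axioms_def)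
  let ?E = "transported_module R emb"
  note E = module_transported_module[OF assms(3)]
  have one: "(\<lambda>_. emb \<one>\<^bsub>R\<^esub>) \<in> {..<1::nat} \<rightarrow> carrier ?E"
    using transported_module_simps(1)[OF assms(3)] by auto
  note gen = transported_module_generator[OF assms(3)]
  have coh: "?coh \<longleftrightarrow> S_finite_relations R S (regular_module R) (carrier R)" by (rule S_coherent_ring_iff)
  have from_E: ?coh if "S_finite_relations R S ?E (carrier ?E)"
    using S_finite_relations_inj_hom[OF mod_hom_transported_module[OF assms(3)] _ that] assms(3)
    unfolding coh by simp
  have "?coh \<longleftrightarrow> ?fp"
  proof
    show "?coh \<Longrightarrow> ?fp" unfolding coh using S_finitely_presented_imp_S_coherent by blast
    assume fp: ?fp
    \<comment> \<open>The copy of the ring has a generator without nonzero relations, so it is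
      S-finitely presented, and the assumption makes it S-coherent.\<close>
    have "S_finite_sub R S (seq_module R) (relations R ?E (\<lambda>_. emb \<one>\<^bsub>R\<^esub>) 1)"
      using S_finite_sub_zero[OF module_seq_module] gen(2) by simp
    then have "S_finitely_presented R S ?E"
      unfolding S_finitely_presented_iff[OF E] using one gen(1) by blast
    then have "S_coherent R S ?E" using fp E by blast
    then show ?coh using from_E by (simp add: S_coherent_iff[OF E])
  qed
  moreover have "?coh \<longleftrightarrow> ?free"
  proof
    assume ?coh
    then have "S_finite_relations R S F (carrier F)" if "free_module R F" for F :: "('a, 'm) module"
      using S_finite_relations_free_module that by (simp add: coh)
    moreover have "module R F" if "free_module R F" for F :: "('a, 'm) module"
      using that by (simp add: free_module_def)
    ultimately show ?free using S_finite_relations_iff_fg_submodules by blast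
  next
    assume ?free
    moreover have "free_module R ?E" by (rule free_moduleI[OF E one gen(1)]) (rule equalityD1[OF gen(2)])
    ultimately show ?coh by (intro from_E) (simp add: S_finite_relations_iff_fg_submodules[OF E])
  qed
  moreover have res: "?coh \<longleftrightarrow> ?res"
    unfolding coh using residual_S_finite_if_coherent coherent_if_residual_S_finite by blast
  moreover have "?coh \<longleftrightarrow> ?ann \<and> ?int"
  proof
    assume ?coh
    then show "?ann \<and> ?int"
      using fg_ideal_zero residual_S_finite_if_coherent intersection_S_finite_if_coherent
      unfolding coh by blast
  next
    assume "?ann \<and> ?int"
    \<comment> \<open>The cycle is closed through residuals, which already imply coherence.\<close>
    then have ?res using residual_S_finite_if_intersection by blast
    then show ?coh using res by blast
  qed
  ultimately show ?thesis by blast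
qed

end
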